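(* For any countable theory $T\subseteq\mathcal{L}_{\square\Diamond}$ and any formula $\varphi\in\mathcal{L}_{\square\Diamond}$, $T\vdash_{\mathcal{G}_{\square\Diamond}}\varphi$ if and only if $T\models_{GK}\varphi$.
   Context: Language: $Var$ is a set of propositional variables; $\mathcal{L}_{\square\Diamond}=\mathcal{L}_{\square\Diamond}(Var)$ is the set of formulas built from $Var$ and $\bot$ using the binary connectives $\wedge,\vee,\rightarrow$ and the unary modal operators $\square,\Diamond$. Abbreviations: $\top:=\varphi\rightarrow\varphi$, $\lnot\varphi:=\varphi\rightarrow\bot$. A theory is a set of formulas. Semantics: on $[0,1]$ (the standard Gödel algebra) let $a\cdot b=\min(a,b)$, $a\curlyvee b=\max(a,b)$, and $a\Rightarrow b=1$ if $a\le b$, $a\Rightarrow b=b$ otherwise. A GK-model is $M=\langle W,S,e\rangle$ with $W$ a non-empty set of worlds and $S:W\times W\to[0,1]$, $e:W\times Var\to[0,1]$ arbitrary functions. The function $e$ extends to $W\times\mathcal{L}_{\square\Diamond}$ by $e(x,\bot)=0$, $e(x,\varphi\wedge\psi)=e(x,\varphi)\cdot e(x,\psi)$, $e(x,\varphi\vee\psi)=e(x,\varphi)\curlyvee e(x,\psi)$, $e(x,\varphi\rightarrow\psi)=e(x,\varphi)\Rightarrow e(x,\psi)$, $e(x,\square\varphi)=\inf_{y\in W}\{Sxy\Rightarrow e(y,\varphi)\}$, $e(x,\Diamond\varphi)=\sup_{y\in W}\{Sxy\cdot e(y,\varphi)\}$. $T\models_{GK}\varphi$ means: for every GK-model $M=\langle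 W,S,e\rangle$ and every $x\in W$, if $e(x,\theta)=1$ for all $\theta\in T$ then $e(x,\varphi)=1$. Calculus: $\mathcal{G}_{\square\Diamond}$ consists of an axiomatization (with Modus Ponens) of Gödel–Dummett propositional logic, i.e. Heyting (intuitionistic) propositional calculus plus the prelinearity axiom $(\varphi\rightarrow\psi)\vee(\psi\rightarrow\varphi)$, for all formulas of $\mathcal{L}_{\square\Diamond}$, together with the axiom schemes $\square(\varphi\rightarrow\psi)\rightarrow(\square\varphi\rightarrow\square\psi)$; $\Diamond(\varphi\vee\psi)\rightarrow(\Diamond\varphi\vee\Diamond\psi)$; $\lnot\Diamond\bot$; $\Diamond(\varphi\rightarrow\psi)\rightarrow(\square\varphi\rightarrow\Diamond\psi)$; $(\Diamond\varphi\rightarrow\square\psi)\rightarrow\square(\varphi\rightarrow\psi)$; and the inference rules: from $\varphi$ infer $\square\varphi$; from $\varphi\rightarrow\psi$ infer $\Diamond\varphi\rightarrow\Diamond\psi$. $T\vdash_{\mathcal{G}_{\square\Diamond}}\varphi$ denotes derivability of $\varphi$ from assumptions $T$, where the two modal rules may be applied only when the premise is a theorem (derivable without assumptions). *)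

theory Defs
  imports Complex_Main "HOL-Library.Countable_Set"
begin

datatype 'v form =
    Atom 'v
  | Falsum (\<open>\<^bold>\<bottom>\<close>)
  | Con "'v form" "'v form" (infixr \<open>\<^bold>\<and>\<close> 65)
  | Dis "'v form" "'v form" (infixr \<open>\<^bold>\<or>\<close> 60)
  | Imp "'v form" "'v form" (infixr \<open>\<^bold>\<longrightarrow>\<close> 55)
  | Box "'v form" (\<open>\<^bold>\<box> _\<close> [70] 70)
  | Dia "'v form" (\<open>\<^bold>\<diamond> _\<close> [70] 70)

abbreviation Neg :: "'v form \<Rightarrow> 'v form" (\<open>\<^bold>\<not> _\<close> [70] 70) where
  "\<^bold>\<not> \<phi> \<equiv> \<phi> \<^bold>\<longrightarrow> \<^bold>\<bottom>"

inductive goedel_axiom :: "'v form \<Rightarrow> bool" where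
  K: "goedel_axiom (\<phi> \<^bold>\<longrightarrow> (\<psi> \<^bold>\<longrightarrow> \<phi>))"
| S: "goedel_axiom ((\<phi> \<^bold>\<longrightarrow> (\<psi> \<^bold>\<longrightarrow> \<chi>)) \<^bold>\<longrightarrow> ((\<phi> \<^bold>\<longrightarrow> \<psi>) \<^bold>\<longrightarrow> (\<phi> \<^bold>\<longrightarrow> \<chi>)))"
| ConE1: "goedel_axiom ((\<phi> \<^bold>\<and> \<psi>) \<^bold>\<longrightarrow> \<phi>)"
| ConE2: "goedel_axiom ((\<phi> \<^bold>\<and> \<psi>) \<^bold>\<longrightarrow> \<psi>)"
| ConI: "goedel_axiom (\<phi> \<^bold>\<longrightarrow> (\<psi> \<^bold>\<longrightarrow> (\<phi> \<^bold>\<and> \<psi>)))"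
| DisI1: "goedel_axiom (\<phi> \<^bold>\<longrightarrow> (\<phi> \<^bold>\<or> \<psi>))"
| DisI2: "goedel_axiom (\<psi> \<^bold>\<longrightarrow> (\<phi> \<^bold>\<or> \<psi>))"
| DisE: "goedel_axiom ((\<phi> \<^bold>\<longrightarrow> \<chi>) \<^bold>\<longrightarrow> ((\<psi> \<^bold>\<longrightarrow> \<chi>) \<^bold>\<longrightarrow> ((\<phi> \<^bold>\<or> \<psi>) \<^bold>\<longrightarrow> \<chi>)))"
| ExFalso: "goedel_axiom (\<^bold>\<bottom> \<^bold>\<longrightarrow> \<phi>)"
| Prelinearity: "goedel_axiom ((\<phi> \<^bold>\<longrightarrow> \<psi>) \<^bold>\<or> (\<psi> \<^bold>\<longrightarrow> \<phi>))"

inductive modal_axiom :: "'v form \<Rightarrow> bool" where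
  BoxImp: "modal_axiom (\<^bold>\<box> (\<phi> \<^bold>\<longrightarrow> \<psi>) \<^bold>\<longrightarrow> (\<^bold>\<box> \<phi> \<^bold>\<longrightarrow> \<^bold>\<box> \<psi>))"
| DiaDis: "modal_axiom (\<^bold>\<diamond> (\<phi> \<^bold>\<or> \<psi>) \<^bold>\<longrightarrow> (\<^bold>\<diamond> \<phi> \<^bold>\<or> \<^bold>\<diamond> \<psi>))"
| DiaFalsum: "modal_axiom (\<^bold>\<not> (\<^bold>\<diamond> \<^bold>\<bottom>))"
| DiaImp: "modal_axiom (\<^bold>\<diamond> (\<phi> \<^bold>\<longrightarrow> \<psi>) \<^bold>\<longrightarrow> (\<^bold>\<box> \<phi> \<^bold>\<longrightarrow> \<^bold>\<diamond> \<psi>))"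
| DiaBox: "modal_axiom ((\<^bold>\<diamond> \<phi> \<^bold>\<longrightarrow> \<^bold>\<box> \<psi>) \<^bold>\<longrightarrow> \<^bold>\<box> (\<phi> \<^bold>\<longrightarrow> \<psi>))"

text \<open>The premises of the two modal rules are derived from the empty theory, so these rules
  are applied to theorems only.\<close>

inductive derivable :: "'v form set \<Rightarrow> 'v form \<Rightarrow> bool" (infix \<open>\<turnstile>\<close> 50) where
  Goedel: "goedel_axiom \<phi> \<Longrightarrow> T \<turnstile> \<phi>"
| Modal: "modal_axiom \<phi> \<Longrightarrow> T \<turnstile> \<phi>"
| Assm: "\<phi> \<in> T \<Longrightarrow> T \<turnstile> \<phi>"
| MP: "T \<turnstile> \<phi> \<Longrightarrow> T \<turnstile> \<phi> \<^bold>\<longrightarrow> \<psi> \<Longrightarrow> T \<turnstile> \<psi>"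
| BoxRule: "{} \<turnstile> \<phi> \<Longrightarrow> T \<turnstile> \<^bold>\<box> \<phi>"
| DiaRule: "{} \<turnstile> \<phi> \<^bold>\<longrightarrow> \<psi> \<Longrightarrow> T \<turnstile> \<^bold>\<diamond> \<phi> \<^bold>\<longrightarrow> \<^bold>\<diamond> \<psi>"

definition goedel_imp :: "real \<Rightarrow> real \<Rightarrow> real" where
  "goedel_imp a b = (if a \<le> b then 1 else b)"

text \<open>The set of worlds is a subset of a type; the values of \<open>S\<close> and \<open>e\<close> outside it are
  irrelevant.\<close>

definition gk_model :: "'w set \<Rightarrow> ('w \<Rightarrow> 'w \<Rightarrow> real) \<Rightarrow> ('w \<Rightarrow> 'v \<Rightarrow> real) \<Rightarrow> bool" where
  "gk_model W S e \<longleftrightarrow> W \<noteq> {} \<and> (\<forall>x\<in>W. \<forall>y\<in>W. S x y \<in> {0..1}) \<and> (\<forall>x\<in>W. \<forall>p. e x p \<in> {0..1})"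

text \<open>In a model, the infima and suprema below are over nonempty sets of reals in the unit
  interval.\<close>

primrec gk_eval ::
  "'w set \<Rightarrow> ('w \<Rightarrow> 'w \<Rightarrow> real) \<Rightarrow> ('w \<Rightarrow> 'v \<Rightarrow> real) \<Rightarrow> 'w \<Rightarrow> 'v form \<Rightarrow> real" where
  "gk_eval W S e x (Atom p) = e x p"
| "gk_eval W S e x \<^bold>\<bottom> = 0"
| "gk_eval W S e x (\<phi> \<^bold>\<and> \<psi>) = min (gk_eval W S e x \<phi>) (gk_eval W S e x \<psi>)"
| "gk_eval W S e x (\<phi> \<^bold>\<or> \<psi>) = max (gk_eval W S e x \<phi>) (gk_eval W S e x \<psi>)"
| "gk_eval W S e x (\<phi> \<^bold>\<longrightarrow> \<psi>) = goedel_imp (gk_eval W S e x \<phi>) (gk_eval W S e x \<psi>)"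
| "gk_eval W S e x (\<^bold>\<box> \<phi>) = (INF y\<in>W. goedel_imp (S x y) (gk_eval W S e y \<phi>))"
| "gk_eval W S e x (\<^bold>\<diamond> \<phi>) = (SUP y\<in>W. min (S x y) (gk_eval W S e y \<phi>))"

text \<open>HOL cannot quantify over all types inside a formula, so consequence over all GK-models is
  relative to a type \<open>'w\<close> from which the worlds are drawn. The set of worlds may be any nonempty
  subset of \<open>'w\<close>. The logic does not have the finite model property, so \<open>'w\<close> has to be infinite
  for completeness to hold.\<close>

definition gk_entails :: "'w itself \<Rightarrow> 'v form set \<Rightarrow> 'v form \<Rightarrow> bool" where
  "gk_entails (_ :: 'w itself) T \<phi> \<longleftrightarrow>
    (\<forall>(W :: 'w set) S e. gk_model W S e \<longrightarrow>
      (\<forall>x\<in>W. (\<forall>\<theta>\<in>T. gk_eval W S e x \<theta> = 1) \<longrightarrow> gk_eval W S e x \<phi> = 1))"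

end

theory Submission
  imports Defs
begin

text \<open>
  For completeness, a theory \<open>P\<close> that is prime and closed under derivability orders the formulas
  linearly, by \<open>\<phi> \<longrightarrow> \<psi> \<in> P\<close>. A countermodel is an infinite tree whose worlds are such theories,
  each with an order embedding of the relevant countable set of formulas into one common chain.
  If \<open>\<box>\<phi>\<close> has the value \<open>r < 1\<close> at a world, then there are successors at which \<open>\<phi>\<close> has a value
  arbitrarily little above \<open>r\<close> and below the label of the edge. If \<open>\<diamond>\<phi>\<close> has the value
  \<open>r > 0\<close>, there is a successor at which \<open>\<phi>\<close> has the value \<open>1\<close>, along an edge with label \<open>r\<close>.

  The values at a successor \<open>y\<close> of \<open>x\<close> have to interpolate between those of \<open>\<box>\<psi>\<close> and \<open>\<diamond>\<psi>\<close>
  at \<open>x\<close>. In the unit interval there may be no room for this: lower and upper bounds can converge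
  to the same real number. The chain therefore consists of the sequences of reals in the unit
  interval, ordered lexicographically. The values at a world depend on finitely many coordinates
  only, and the next coordinate opens a gap in every cut. A whole model uses countably many
  values, and these embed into the unit interval in such a way that the infima for \<open>\<box>\<close> survive.
\<close>

subsection \<open>Prime theories\<close>

lemma derivable_mono: "T \<turnstile> \<phi> \<Longrightarrow> T \<subseteq> T' \<Longrightarrow> T' \<turnstile> \<phi>"
  by (induction arbitrary: T' rule: derivable.induct) (auto intro: derivable.intros)

lemma theorem_derivable: "{} \<turnstile> \<phi> \<Longrightarrow> T \<turnstile> \<phi>"
  by (erule derivable_mono) simp

lemma derivable_imp_refl: "T \<turnstile> \<phi> \<^bold>\<longrightarrow> \<phi>"
  by (meson MP Goedel goedel_axiom.K goedel_axiom.S)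

text \<open>The modal rules do no harm: their premises are theorems, so their conclusions are
  derivable from \<open>T\<close> itself, and axiom \<open>K\<close> puts \<phi> in front.\<close>

lemma deduction: "insert \<phi> T \<turnstile> \<psi> \<Longrightarrow> T \<turnstile> \<phi> \<^bold>\<longrightarrow> \<psi>"
proof (induction "insert \<phi> T" \<psi> rule: derivable.induct)
  case (Assm \<psi>)
  then show ?case
    by (metis derivable.Assm Goedel MP derivable_imp_refl goedel_axiom.K insertE)
next
  case (MP \<psi> \<chi>)
  then show ?case by (meson Goedel derivable.MP goedel_axiom.S)
qed (meson Goedel Modal BoxRule DiaRule MP goedel_axiom.K)+

lemma deduction_iff: "T \<turnstile> \<phi> \<^bold>\<longrightarrow> \<psi> \<longleftrightarrow> insert \<phi> T \<turnstile> \<psi>"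
  by (meson Assm MP deduction derivable_mono insertI1 subset_insertI)

lemma derivable_con: "T \<turnstile> \<phi> \<^bold>\<and> \<psi> \<longleftrightarrow> T \<turnstile> \<phi> \<and> T \<turnstile> \<psi>"
  by (meson Goedel MP goedel_axiom.ConE1 goedel_axiom.ConE2 goedel_axiom.ConI)

lemma derivable_disE: "T \<turnstile> \<phi> \<^bold>\<or> \<psi> \<Longrightarrow> insert \<phi> T \<turnstile> \<chi> \<Longrightarrow> insert \<psi> T \<turnstile> \<chi> \<Longrightarrow> T \<turnstile> \<chi>"
  by (meson Goedel MP goedel_axiom.DisE deduction)

lemma cut: "T \<turnstile> \<phi> \<Longrightarrow> insert \<phi> T \<turnstile> \<psi> \<Longrightarrow> T \<turnstile> \<psi>"
  using MP deduction by blast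

text \<open>Modus ponens takes its premises from two members of the chain, and the larger of them
  derives both. Zorn's lemma asks for this in \<open>prime_extension\<close>.\<close>

lemma derivable_compact_chain:
  assumes "subset.chain A C" "C \<noteq> {}" "\<Union>C \<turnstile> \<phi>"
  shows "\<exists>M\<in>C. M \<turnstile> \<phi>"
  using assms(3)
proof (induction "\<Union>C" \<phi> rule: derivable.induct)
  case (MP \<phi> \<psi>)
  then obtain M N where *: "M \<in> C" "M \<turnstile> \<phi>" "N \<in> C" "N \<turnstile> \<phi> \<^bold>\<longrightarrow> \<psi>" by blast
  with assms(1) have "M \<subseteq> N \<or> N \<subseteq> M" by (auto simp: subset_chain_def)
  then show ?case using * by (meson derivable.MP derivable_mono)
qed (use assms(2) in \<open>auto intro: derivable.intros\<close>)

text \<open>Conjunctions merge the assumptions used into a single one. The resulting implication is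
  a theorem, so the modal rules may be applied to it.\<close>

lemma derivable_from_directed:
  assumes "\<Gamma> \<turnstile> \<phi>" "\<Gamma> \<noteq> {}"
    and "\<And>\<psi> \<chi>. \<psi> \<in> \<Gamma> \<Longrightarrow> \<chi> \<in> \<Gamma> \<Longrightarrow> \<psi> \<^bold>\<and> \<chi> \<in> \<Gamma>"
  shows "\<exists>\<psi>\<in>\<Gamma>. {} \<turnstile> \<psi> \<^bold>\<longrightarrow> \<phi>"
  using assms
proof (induction rule: derivable.induct)
  case (Assm \<phi> \<Gamma>)
  then show ?case by (auto intro: derivable_imp_refl)
next
  case (MP \<Gamma> \<phi> \<psi>)
  obtain a where a: "a \<in> \<Gamma>" "{a} \<turnstile> \<phi>"
    using MP.IH(1)[OF MP.prems] deduction_iff by blast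
  obtain b where b: "b \<in> \<Gamma>" "{b} \<turnstile> \<phi> \<^bold>\<longrightarrow> \<psi>"
    using MP.IH(2)[OF MP.prems] deduction_iff by blast
  have "{a, a \<^bold>\<and> b} \<turnstile> \<phi>" "{b, a \<^bold>\<and> b} \<turnstile> \<phi> \<^bold>\<longrightarrow> \<psi>"
    using a(2) b(2) by (auto elim: derivable_mono)
  moreover have "{a \<^bold>\<and> b} \<turnstile> a" "{a \<^bold>\<and> b} \<turnstile> b"
    using derivable_con Assm by blast+
  ultimately have "{a \<^bold>\<and> b} \<turnstile> \<psi>" by (meson cut derivable.MP)
  then show ?case
    using MP.prems(2)[OF a(1) b(1)] deduction by blast
qed (meson ex_in_conv Goedel Modal BoxRule DiaRule MP goedel_axiom.K)+

section \<open>Prime theories as linear preorders of formulas\<close>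

locale prime_theory =
  fixes P :: "'v form set"
  assumes closed: "P \<turnstile> \<phi> \<Longrightarrow> \<phi> \<in> P"
    and consistent: "\<^bold>\<bottom> \<notin> P"
    and prime: "\<phi> \<^bold>\<or> \<psi> \<in> P \<Longrightarrow> \<phi> \<in> P \<or> \<psi> \<in> P"
begin

lemma mem_iff: "\<phi> \<in> P \<longleftrightarrow> P \<turnstile> \<phi>"
  using closed Assm by blast

lemma theorem_mem: "{} \<turnstile> \<phi> \<Longrightarrow> \<phi> \<in> P"
  using closed theorem_derivable by blast

lemma modal_mem: "modal_axiom \<phi> \<Longrightarrow> \<phi> \<in> P"
  using closed Modal by blast

lemma mp: "\<phi> \<^bold>\<longrightarrow> \<psi> \<in> P \<Longrightarrow> \<phi> \<in> P \<Longrightarrow> \<psi> \<in> P"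
  by (meson mem_iff MP)

lemma imp_refl: "\<phi> \<^bold>\<longrightarrow> \<phi> \<in> P"
  by (simp add: closed derivable_imp_refl)

lemma imp_trans: "\<phi> \<^bold>\<longrightarrow> \<psi> \<in> P \<Longrightarrow> \<psi> \<^bold>\<longrightarrow> \<chi> \<in> P \<Longrightarrow> \<phi> \<^bold>\<longrightarrow> \<chi> \<in> P"
  unfolding mem_iff by (meson Goedel MP goedel_axiom.K goedel_axiom.S)

lemma imp_total: "\<phi> \<^bold>\<longrightarrow> \<psi> \<in> P \<or> \<psi> \<^bold>\<longrightarrow> \<phi> \<in> P"
  by (meson prime closed Goedel Prelinearity)

lemma imp_mem: "\<psi> \<in> P \<Longrightarrow> \<phi> \<^bold>\<longrightarrow> \<psi> \<in> P"
  unfolding mem_iff by (meson Goedel MP goedel_axiom.K)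

lemma imp_contract: "\<phi> \<^bold>\<longrightarrow> (\<psi> \<^bold>\<longrightarrow> \<chi>) \<in> P \<Longrightarrow> \<phi> \<^bold>\<longrightarrow> \<psi> \<in> P \<Longrightarrow> \<phi> \<^bold>\<longrightarrow> \<chi> \<in> P"
  unfolding mem_iff by (meson Goedel MP goedel_axiom.S)

lemma falsum_imp: "\<^bold>\<bottom> \<^bold>\<longrightarrow> \<phi> \<in> P"
  by (meson closed Goedel ExFalso)

lemma con_imp: "\<phi> \<^bold>\<and> \<psi> \<^bold>\<longrightarrow> \<phi> \<in> P" "\<phi> \<^bold>\<and> \<psi> \<^bold>\<longrightarrow> \<psi> \<in> P"
  by (meson closed Goedel ConE1 ConE2)+

lemma imp_con: "\<chi> \<^bold>\<longrightarrow> \<phi> \<in> P \<Longrightarrow> \<chi> \<^bold>\<longrightarrow> \<psi> \<in> P \<Longrightarrow> \<chi> \<^bold>\<longrightarrow> (\<phi> \<^bold>\<and> \<psi>) \<in> P"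
  by (simp add: mem_iff deduction_iff derivable_con)

lemma imp_dis: "\<phi> \<^bold>\<longrightarrow> (\<phi> \<^bold>\<or> \<psi>) \<in> P" "\<psi> \<^bold>\<longrightarrow> (\<phi> \<^bold>\<or> \<psi>) \<in> P"
  by (meson closed Goedel DisI1 DisI2)+

lemma dis_imp: "\<phi> \<^bold>\<longrightarrow> \<chi> \<in> P \<Longrightarrow> \<psi> \<^bold>\<longrightarrow> \<chi> \<in> P \<Longrightarrow> (\<phi> \<^bold>\<or> \<psi>) \<^bold>\<longrightarrow> \<chi> \<in> P"
  unfolding mem_iff by (meson Goedel MP goedel_axiom.DisE)

text \<open>Linearity compares \<open>\<phi> \<longrightarrow> \<psi>\<close> with \<phi>. Were
  \<phi> the smaller one, contraction would give \<open>\<phi> \<longrightarrow> \<psi>\<close>; so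
  the implication is below \<phi>, hence below \<psi>. An implication that is not true thus has the
  value of its consequent.\<close>

lemma imp_consequent: "\<phi> \<^bold>\<longrightarrow> \<psi> \<notin> P \<Longrightarrow> (\<phi> \<^bold>\<longrightarrow> \<psi>) \<^bold>\<longrightarrow> \<psi> \<in> P"
  by (metis imp_contract imp_refl imp_total)

lemma box_mono: "{} \<turnstile> \<phi> \<^bold>\<longrightarrow> \<psi> \<Longrightarrow> \<^bold>\<box> \<phi> \<^bold>\<longrightarrow> \<^bold>\<box> \<psi> \<in> P"
  by (meson BoxRule mp theorem_mem modal_mem BoxImp)

lemma dia_mono: "{} \<turnstile> \<phi> \<^bold>\<longrightarrow> \<psi> \<Longrightarrow> \<^bold>\<diamond> \<phi> \<^bold>\<longrightarrow> \<^bold>\<diamond> \<psi> \<in> P"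
  by (meson DiaRule theorem_mem)

lemma box_con:
  assumes "\<chi> \<^bold>\<longrightarrow> \<^bold>\<box> \<phi> \<in> P" "\<chi> \<^bold>\<longrightarrow> \<^bold>\<box> \<psi> \<in> P"
  shows "\<chi> \<^bold>\<longrightarrow> \<^bold>\<box> (\<phi> \<^bold>\<and> \<psi>) \<in> P"
proof -
  have "\<^bold>\<box> \<phi> \<^bold>\<longrightarrow> \<^bold>\<box> (\<psi> \<^bold>\<longrightarrow> (\<phi> \<^bold>\<and> \<psi>)) \<in> P"
    by (intro box_mono Goedel ConI)
  then show ?thesis
    by (meson BoxImp assms imp_contract imp_trans modal_mem)
qed

lemma box_imp: "\<^bold>\<diamond> \<phi> \<^bold>\<longrightarrow> \<^bold>\<box> \<psi> \<in> P \<Longrightarrow> \<^bold>\<box> (\<phi> \<^bold>\<longrightarrow> \<psi>) \<in> P"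
  by (meson DiaBox modal_mem mp)

end

text \<open>Zorn's lemma gives a maximal superset of \<Gamma> that derives nothing in \<Delta>. If
  it contained a disjunction but neither disjunct, adding either one would derive a member of
  \<Delta>; it would then derive the disjunction of two such members, and so a member of \<Delta>. A
  whole set is avoided because a diamond successor has to keep out many formulas at once.\<close>

lemma prime_extension:
  assumes "\<Delta> \<noteq> {}" and "\<And>\<delta>. \<delta> \<in> \<Delta> \<Longrightarrow> \<not> \<Gamma> \<turnstile> \<delta>"
    and "\<And>a b. a \<in> \<Delta> \<Longrightarrow> b \<in> \<Delta> \<Longrightarrow> \<exists>c\<in>\<Delta>. {} \<turnstile> (a \<^bold>\<or> b) \<^bold>\<longrightarrow> c"
  obtains Q where "prime_theory Q" "\<Gamma> \<subseteq> Q" "Q \<inter> \<Delta> = {}"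
proof -
  let ?A = "{M. \<Gamma> \<subseteq> M \<and> (\<forall>\<delta>\<in>\<Delta>. \<not> M \<turnstile> \<delta>)}"
  have "\<exists>M\<in>?A. \<forall>X\<in>?A. M \<subseteq> X \<longrightarrow> X = M"
  proof (rule subset_Zorn_nonempty)
    show "?A \<noteq> {}" using assms(2) by blast
    fix C assume "C \<noteq> {}" "subset.chain ?A C"
    then show "\<Union>C \<in> ?A"
      using derivable_compact_chain[of ?A C] by (fastforce simp: subset_chain_def)
  qed
  then obtain M where M: "M \<in> ?A" and max: "\<forall>X\<in>?A. M \<subseteq> X \<longrightarrow> X = M"
    by (rule bexE)
  then have "\<Gamma> \<subseteq> M" and avoids: "\<And>\<delta>. \<delta> \<in> \<Delta> \<Longrightarrow> \<not> M \<turnstile> \<delta>"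
    by simp_all
  have extend: "\<exists>\<delta>\<in>\<Delta>. insert \<phi> M \<turnstile> \<delta>" if "\<phi> \<notin> M" for \<phi>
  proof (rule ccontr)
    assume "\<not> ?thesis"
    then have "insert \<phi> M \<in> ?A" using \<open>\<Gamma> \<subseteq> M\<close> by auto
    then show False using max that by blast
  qed
  have closed: "\<phi> \<in> M" if "M \<turnstile> \<phi>" for \<phi>
    using extend avoids cut that by blast
  have "prime_theory M"
  proof
    show "\<^bold>\<bottom> \<notin> M"
      using avoids assms(1) by (meson Assm ExFalso Goedel MP all_not_in_conv)
    fix \<phi> \<psi> assume dis: "\<phi> \<^bold>\<or> \<psi> \<in> M"
    show "\<phi> \<in> M \<or> \<psi> \<in> M"
    proof (rule ccontr)
      assume "\<not> (\<phi> \<in> M \<or> \<psi> \<in> M)"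
      then obtain a b where ab: "a \<in> \<Delta>" "insert \<phi> M \<turnstile> a" "b \<in> \<Delta>" "insert \<psi> M \<turnstile> b"
        using extend by blast
      then have "insert \<phi> M \<turnstile> a \<^bold>\<or> b" "insert \<psi> M \<turnstile> a \<^bold>\<or> b"
        by (meson DisI1 DisI2 Goedel MP)+
      then have "M \<turnstile> a \<^bold>\<or> b" using dis Assm derivable_disE by blast
      then show False
        using assms(3)[OF ab(1,3)] avoids theorem_derivable MP by blast
    qed
  qed (fact closed)
  moreover have "M \<inter> \<Delta> = {}" using avoids Assm by blast
  ultimately show thesis using that \<open>\<Gamma> \<subseteq> M\<close> by blast
qed

text \<open>Any theory containing all \<open>\<psi>\<close> whose box has a greater value than \<open>\<box>\<phi>\<close> will do.
  The set of these \<open>\<psi>\<close> is directed because \<open>P\<close> orders the formulas linearly, and the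
  condition on \<open>\<diamond>\<close> is forced by the axiom \<open>DiaBox\<close>.\<close>

lemma (in prime_theory) box_successor:
  assumes "\<^bold>\<box> \<phi> \<notin> P"
  obtains Q where "prime_theory Q" "\<phi> \<notin> Q"
    "\<And>\<psi>. \<psi> \<notin> Q \<Longrightarrow> \<^bold>\<box> \<psi> \<^bold>\<longrightarrow> \<^bold>\<box> \<phi> \<in> P"
    "\<And>\<psi>. \<^bold>\<box> \<psi> \<in> P \<Longrightarrow> \<psi> \<in> Q"
    "\<And>\<psi>. \<^bold>\<diamond> \<psi> \<^bold>\<longrightarrow> \<^bold>\<box> \<phi> \<in> P \<Longrightarrow> \<psi> \<notin> Q"
proof -
  define \<Gamma> where "\<Gamma> = {\<psi>. \<^bold>\<box> \<psi> \<^bold>\<longrightarrow> \<^bold>\<box> \<phi> \<notin> P}"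
  have con: "\<psi> \<^bold>\<and> \<chi> \<in> \<Gamma>" if "\<psi> \<in> \<Gamma>" "\<chi> \<in> \<Gamma>" for \<psi> \<chi>
  proof (rule ccontr)
    assume "\<psi> \<^bold>\<and> \<chi> \<notin> \<Gamma>"
    then have *: "\<^bold>\<box> (\<psi> \<^bold>\<and> \<chi>) \<^bold>\<longrightarrow> \<^bold>\<box> \<phi> \<in> P" by (simp add: \<Gamma>_def)
    consider "\<^bold>\<box> \<psi> \<^bold>\<longrightarrow> \<^bold>\<box> \<chi> \<in> P" | "\<^bold>\<box> \<chi> \<^bold>\<longrightarrow> \<^bold>\<box> \<psi> \<in> P" using imp_total by blast
    then show False
      using that * box_con imp_refl imp_trans unfolding \<Gamma>_def by cases blast+
  qed
  have box_mem: "\<psi> \<in> \<Gamma>" if "\<^bold>\<box> \<psi> \<in> P" for \<psi>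
    using that assms mp unfolding \<Gamma>_def by blast
  have "\<Gamma> \<noteq> {}"
    using box_mem[of "\<phi> \<^bold>\<longrightarrow> \<phi>"] by (metis BoxRule derivable_imp_refl empty_iff theorem_mem)
  have "\<not> \<Gamma> \<turnstile> \<phi>"
    using derivable_from_directed[OF _ \<open>\<Gamma> \<noteq> {}\<close> con] box_mono unfolding \<Gamma>_def by blast
  moreover have "{} \<turnstile> (\<phi> \<^bold>\<or> \<phi>) \<^bold>\<longrightarrow> \<phi>"
    by (meson DisE Goedel MP derivable_imp_refl)
  ultimately obtain Q where Q: "prime_theory Q" "\<Gamma> \<subseteq> Q" "Q \<inter> {\<phi>} = {}"
    using prime_extension[of "{\<phi>}" \<Gamma>] by auto
  show thesis
  proof (rule that[OF Q(1)])
    show "\<phi> \<notin> Q" using Q by auto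
    show "\<^bold>\<box> \<psi> \<^bold>\<longrightarrow> \<^bold>\<box> \<phi> \<in> P" if "\<psi> \<notin> Q" for \<psi> using that Q by (auto simp: \<Gamma>_def)
    show "\<psi> \<in> Q" if "\<^bold>\<box> \<psi> \<in> P" for \<psi> using that Q box_mem by auto
    show "\<psi> \<notin> Q" if "\<^bold>\<diamond> \<psi> \<^bold>\<longrightarrow> \<^bold>\<box> \<phi> \<in> P" for \<psi>
      using box_mem[OF box_imp[OF that]] Q prime_theory.mp by blast
  qed
qed

text \<open>With the value of \<open>\<diamond>\<phi>\<close> as the label of the edge, \<Gamma>
  collects what must be true at the successor and \<Delta> what must not. By \<open>DiaImp\<close>,
  \<phi> and \<Gamma> together derive nothing in \<Delta>. By \<open>DiaDis\<close> and linearity,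
  \<Delta> is closed under disjunction.\<close>

lemma (in prime_theory) dia_successor:
  assumes "\<^bold>\<diamond> \<phi> \<^bold>\<longrightarrow> \<^bold>\<bottom> \<notin> P"
  obtains Q where "prime_theory Q" "\<phi> \<in> Q"
    "\<And>\<psi>. \<^bold>\<diamond> \<phi> \<^bold>\<longrightarrow> \<^bold>\<box> \<psi> \<in> P \<Longrightarrow> \<psi> \<in> Q"
    "\<And>\<psi>. \<^bold>\<diamond> \<phi> \<^bold>\<longrightarrow> \<^bold>\<diamond> \<psi> \<notin> P \<Longrightarrow> \<psi> \<notin> Q"
proof -
  define \<Gamma> where "\<Gamma> = {\<psi>. \<^bold>\<diamond> \<phi> \<^bold>\<longrightarrow> \<^bold>\<box> \<psi> \<in> P}"
  define \<Delta> where "\<Delta> = {\<delta>. \<^bold>\<diamond> \<phi> \<^bold>\<longrightarrow> \<^bold>\<diamond> \<delta> \<notin> P}"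
  have con: "\<psi> \<^bold>\<and> \<chi> \<in> \<Gamma>" if "\<psi> \<in> \<Gamma>" "\<chi> \<in> \<Gamma>" for \<psi> \<chi>
    using that box_con by (auto simp: \<Gamma>_def)
  have "\<phi> \<^bold>\<longrightarrow> \<phi> \<in> \<Gamma>"
    unfolding \<Gamma>_def by (simp add: BoxRule derivable_imp_refl imp_mem theorem_mem)
  then have "\<Gamma> \<noteq> {}" by blast
  have avoid: "\<not> insert \<phi> \<Gamma> \<turnstile> \<delta>" if "\<delta> \<in> \<Delta>" for \<delta>
  proof
    assume "insert \<phi> \<Gamma> \<turnstile> \<delta>"
    then obtain \<psi> where \<psi>: "\<psi> \<in> \<Gamma>" "{} \<turnstile> \<psi> \<^bold>\<longrightarrow> (\<phi> \<^bold>\<longrightarrow> \<delta>)"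
      using derivable_from_directed[OF _ \<open>\<Gamma> \<noteq> {}\<close> con] deduction by blast
    then have "{} \<turnstile> \<phi> \<^bold>\<longrightarrow> (\<psi> \<^bold>\<longrightarrow> \<delta>)" by (simp add: deduction_iff insert_commute)
    then have "\<^bold>\<diamond> \<phi> \<^bold>\<longrightarrow> (\<^bold>\<box> \<psi> \<^bold>\<longrightarrow> \<^bold>\<diamond> \<delta>) \<in> P"
      by (meson DiaImp dia_mono imp_trans modal_mem)
    then show False using \<psi>(1) that imp_contract unfolding \<Gamma>_def \<Delta>_def by blast
  qed
  have dis: "a \<^bold>\<or> b \<in> \<Delta>" if "a \<in> \<Delta>" "b \<in> \<Delta>" for a b
  proof (rule ccontr)
    assume "a \<^bold>\<or> b \<notin> \<Delta>"
    then have *: "\<^bold>\<diamond> \<phi> \<^bold>\<longrightarrow> (\<^bold>\<diamond> a \<^bold>\<or> \<^bold>\<diamond> b) \<in> P"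
      unfolding \<Delta>_def by (simp add: DiaDis imp_trans[OF _ modal_mem])
    consider "\<^bold>\<diamond> a \<^bold>\<longrightarrow> \<^bold>\<diamond> b \<in> P" | "\<^bold>\<diamond> b \<^bold>\<longrightarrow> \<^bold>\<diamond> a \<in> P" using imp_total by blast
    then show False
      using that * dis_imp imp_refl imp_trans unfolding \<Delta>_def by cases blast+
  qed
  have "\<^bold>\<bottom> \<in> \<Delta>"
    using assms imp_trans[OF _ modal_mem[OF DiaFalsum]] by (auto simp: \<Delta>_def)
  then obtain Q where Q: "prime_theory Q" "insert \<phi> \<Gamma> \<subseteq> Q" "Q \<inter> \<Delta> = {}"
    using prime_extension[of \<Delta> "insert \<phi> \<Gamma>"] avoid dis derivable_imp_refl
    by (metis empty_iff)
  then show thesis using that by (auto simp: \<Gamma>_def \<Delta>_def)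
qed

subsection \<open>Soundness\<close>

lemma gk_eval_unit:
  assumes "gk_model W S e" "x \<in> W"
  shows "0 \<le> gk_eval W S e x \<phi> \<and> gk_eval W S e x \<phi> \<le> 1"
  using assms(2)
proof (induction \<phi> arbitrary: x)
  case (Atom p)
  then show ?case using assms(1) by (auto simp: gk_model_def)
next
  case (Box \<phi>)
  have "0 \<le> goedel_imp (S x y) (gk_eval W S e y \<phi>)" if "y \<in> W" for y
    using Box.IH[OF that] by (simp add: goedel_imp_def)
  moreover have "goedel_imp (S x x) (gk_eval W S e x \<phi>) \<le> 1"
    using Box by (simp add: goedel_imp_def)
  ultimately show ?case
    using Box.prems by (auto intro!: cINF_greatest cINF_lower2[where x = x] bdd_belowI[where m = 0])
next
  case (Dia \<phi>)
  have S: "0 \<le> S x y \<and> S x y \<le> 1" if "y \<in> W" for y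
    using assms(1) that Dia.prems by (auto simp: gk_model_def)
  have "min (S x y) (gk_eval W S e y \<phi>) \<le> 1" if "y \<in> W" for y
    using S[OF that] by (simp add: min_le_iff_disj)
  moreover have "0 \<le> min (S x x) (gk_eval W S e x \<phi>)"
    using Dia S by simp
  ultimately show ?case
    using Dia.prems by (auto intro!: cSUP_least cSUP_upper2[where x = x] bdd_aboveI[where M = 1])
qed (auto simp: goedel_imp_def min_le_iff_disj le_max_iff_disj)

lemma goedel_imp_residuation: "a \<le> 1 \<Longrightarrow> a \<le> goedel_imp b c \<longleftrightarrow> min a b \<le> c"
  by (auto simp: goedel_imp_def min_def)

text \<open>These are the inequalities behind \<open>BoxImp\<close>, \<open>DiaImp\<close> and
  \<open>DiaBox\<close> at one successor. The label of the edge is \<open>r\<close> in the first and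
  \<open>s\<close> in the other two.\<close>

lemma goedel_imp_mp: "min p r \<le> goedel_imp a b \<Longrightarrow> min q r \<le> a \<Longrightarrow> min (min p q) r \<le> b"
  and goedel_imp_min: "min q s \<le> a \<Longrightarrow> min s b \<le> c \<Longrightarrow> min (min s (goedel_imp a b)) q \<le> c"
  and goedel_imp_mono:
    "s \<le> 1 \<Longrightarrow> min s a \<le> b \<Longrightarrow> min c s \<le> d \<Longrightarrow> min (goedel_imp b c) s \<le> goedel_imp a d"
  by (auto simp: goedel_imp_def min_le_iff_disj split: if_splits)

lemma goedel_imp_eq_1: "a \<le> 1 \<Longrightarrow> goedel_imp a b = 1 \<longleftrightarrow> a \<le> b"
  by (auto simp: goedel_imp_def)

text \<open>Residuation moves the label to the left-hand side. Together with
  \<open>gk_eval_dia_le\<close>, this replaces infima and suprema by inequalities at single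
  successors, for soundness as well as for the countermodel.\<close>

lemma gk_eval_box_ge:
  assumes "gk_model W S e" "x \<in> W" "r \<le> 1"
  shows "r \<le> gk_eval W S e x (\<^bold>\<box> \<phi>) \<longleftrightarrow> (\<forall>y\<in>W. min r (S x y) \<le> gk_eval W S e y \<phi>)"
proof -
  have "bdd_below ((\<lambda>y. goedel_imp (S x y) (gk_eval W S e y \<phi>)) ` W)"
    using gk_eval_unit[OF assms(1)] by (auto intro!: bdd_belowI[where m = 0] simp: goedel_imp_def)
  then show ?thesis
    using assms(2,3) le_cINF_iff[of W "\<lambda>y. goedel_imp (S x y) (gk_eval W S e y \<phi>)" r]
    by (auto simp: goedel_imp_residuation)
qed

lemma gk_eval_dia_le:
  assumes "gk_model W S e" "x \<in> W"
  shows "gk_eval W S e x (\<^bold>\<diamond> \<phi>) \<le> r \<longleftrightarrow> (\<forall>y\<in>W. min (S x y) (gk_eval W S e y \<phi>) \<le> r)"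
proof -
  have "bdd_above ((\<lambda>y. min (S x y) (gk_eval W S e y \<phi>)) ` W)"
    using gk_eval_unit[OF assms(1)] by (auto intro!: bdd_aboveI[where M = 1] simp: min_le_iff_disj)
  then show ?thesis
    using assms(2) cSUP_le_iff[of W "\<lambda>y. min (S x y) (gk_eval W S e y \<phi>)" r] by auto
qed

lemma goedel_axiom_sound:
  assumes "goedel_axiom \<phi>" "gk_model W S e" "x \<in> W"
  shows "gk_eval W S e x \<phi> = 1"
proof -
  note u = gk_eval_unit[OF assms(2,3)]
  show ?thesis
    using assms(1)
  proof cases
    case (S \<phi> \<psi> \<chi>)
    then show ?thesis using u[of \<phi>] u[of \<psi>] u[of \<chi>] by (simp add: goedel_imp_def)
  next
    case (DisE \<phi> \<chi> \<psi>)
    then show ?thesis using u[of \<phi>] u[of \<psi>] u[of \<chi>] by (simp add: goedel_imp_def max_def)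
  next
    case (Prelinearity \<phi> \<psi>)
    then show ?thesis using u[of \<phi>] u[of \<psi>] by (simp add: goedel_imp_def max_def)
  next
    case (ConI \<phi> \<psi>)
    then show ?thesis using u[of \<phi>] u[of \<psi>] by (simp add: goedel_imp_def min_def)
  qed (use u in \<open>auto simp: goedel_imp_def\<close>)
qed

lemma modal_axiom_sound:
  assumes "modal_axiom \<phi>" and M: "gk_model W S e" and x: "x \<in> W"
  shows "gk_eval W S e x \<phi> = 1"
proof -
  note u = gk_eval_unit[OF M]
  note ge = gk_eval_box_ge[OF M x] and le = gk_eval_dia_le[OF M x]
  have box: "min (gk_eval W S e x (\<^bold>\<box> \<psi>)) (S x y) \<le> gk_eval W S e y \<psi>" if "y \<in> W" for y \<psi>
    using ge u[OF x] that by blast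
  have dia: "min (S x y) (gk_eval W S e y \<psi>) \<le> gk_eval W S e x (\<^bold>\<diamond> \<psi>)" if "y \<in> W" for y \<psi>
    using le that by blast
  have imp: "gk_eval W S e x (\<psi> \<^bold>\<longrightarrow> \<chi>) = 1"
    if "gk_eval W S e x \<psi> \<le> gk_eval W S e x \<chi>" for \<psi> \<chi>
    using that by (simp add: goedel_imp_def)
  have imp2: "gk_eval W S e x (\<psi> \<^bold>\<longrightarrow> (\<chi> \<^bold>\<longrightarrow> \<xi>)) = 1"
    if "min (gk_eval W S e x \<psi>) (gk_eval W S e x \<chi>) \<le> gk_eval W S e x \<xi>" for \<psi> \<chi> \<xi>
    using that u[OF x] by (intro imp) (simp add: goedel_imp_residuation)
  show ?thesis
    using assms(1)
  proof cases
    case (BoxImp \<phi> \<psi>)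
    have "min (gk_eval W S e x (\<^bold>\<box> (\<phi> \<^bold>\<longrightarrow> \<psi>))) (gk_eval W S e x (\<^bold>\<box> \<phi>)) \<le> gk_eval W S e x (\<^bold>\<box> \<psi>)"
    proof (subst ge)
      show "\<forall>y\<in>W. min (min (gk_eval W S e x (\<^bold>\<box> (\<phi> \<^bold>\<longrightarrow> \<psi>))) (gk_eval W S e x (\<^bold>\<box> \<phi>))) (S x y)
        \<le> gk_eval W S e y \<psi>"
      proof
        fix y assume "y \<in> W"
        then show "min (min (gk_eval W S e x (\<^bold>\<box> (\<phi> \<^bold>\<longrightarrow> \<psi>))) (gk_eval W S e x (\<^bold>\<box> \<phi>))) (S x y)
          \<le> gk_eval W S e y \<psi>"
          using box[of y "\<phi> \<^bold>\<longrightarrow> \<psi>"] box[of y \<phi>] goedel_imp_mp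
          unfolding gk_eval.simps(5) by blast
      qed
    qed (simp add: u[OF x] min_le_iff_disj del: gk_eval.simps)
    then show ?thesis unfolding BoxImp by (rule imp2)
  next
    case (DiaDis \<phi> \<psi>)
    have "gk_eval W S e x (\<^bold>\<diamond> (\<phi> \<^bold>\<or> \<psi>)) \<le> gk_eval W S e x (\<^bold>\<diamond> \<phi> \<^bold>\<or> \<^bold>\<diamond> \<psi>)"
      unfolding le
    proof
      fix y assume "y \<in> W"
      then show "min (S x y) (gk_eval W S e y (\<phi> \<^bold>\<or> \<psi>)) \<le> gk_eval W S e x (\<^bold>\<diamond> \<phi> \<^bold>\<or> \<^bold>\<diamond> \<psi>)"
        using max.mono[OF dia dia] unfolding gk_eval.simps(4) min_max_distrib2 by blast
    qed
    then show ?thesis unfolding DiaDis by (rule imp)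
  next
    case DiaFalsum
    have "gk_eval W S e x (\<^bold>\<diamond> \<^bold>\<bottom>) \<le> gk_eval W S e x \<^bold>\<bottom>"
      unfolding le by simp
    then show ?thesis unfolding DiaFalsum by (rule imp)
  next
    case (DiaImp \<phi> \<psi>)
    have "min (S x y) (gk_eval W S e y (\<phi> \<^bold>\<longrightarrow> \<psi>)) \<le> gk_eval W S e x (\<^bold>\<box> \<phi> \<^bold>\<longrightarrow> \<^bold>\<diamond> \<psi>)"
      if "y \<in> W" for y
    proof -
      have "min (S x y) (gk_eval W S e y (\<phi> \<^bold>\<longrightarrow> \<psi>)) \<le> 1"
        by (simp add: u[OF that] min_le_iff_disj del: gk_eval.simps)
      moreover have "min (min (S x y) (gk_eval W S e y (\<phi> \<^bold>\<longrightarrow> \<psi>))) (gk_eval W S e x (\<^bold>\<box> \<phi>))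
          \<le> gk_eval W S e x (\<^bold>\<diamond> \<psi>)"
        unfolding gk_eval.simps(5) using box[OF that] dia[OF that] by (rule goedel_imp_min)
      ultimately show ?thesis
        unfolding gk_eval.simps(5)[of W S e x] by (subst goedel_imp_residuation)
    qed
    then have "gk_eval W S e x (\<^bold>\<diamond> (\<phi> \<^bold>\<longrightarrow> \<psi>)) \<le> gk_eval W S e x (\<^bold>\<box> \<phi> \<^bold>\<longrightarrow> \<^bold>\<diamond> \<psi>)"
      unfolding le by blast
    then show ?thesis unfolding DiaImp by (rule imp)
  next
    case (DiaBox \<phi> \<psi>)
    have "min (gk_eval W S e x (\<^bold>\<diamond> \<phi> \<^bold>\<longrightarrow> \<^bold>\<box> \<psi>)) (S x y) \<le> gk_eval W S e y (\<phi> \<^bold>\<longrightarrow> \<psi>)"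
      if "y \<in> W" for y
    proof -
      have "S x y \<le> 1" using M x that by (auto simp: gk_model_def)
      then show ?thesis
        unfolding gk_eval.simps(5) using dia[OF that] box[OF that] by (rule goedel_imp_mono)
    qed
    then have "gk_eval W S e x (\<^bold>\<diamond> \<phi> \<^bold>\<longrightarrow> \<^bold>\<box> \<psi>) \<le> gk_eval W S e x (\<^bold>\<box> (\<phi> \<^bold>\<longrightarrow> \<psi>))"
      using ge u[OF x] by blast
    then show ?thesis unfolding DiaBox by (rule imp)
  qed
qed

lemma soundness:
  assumes "T \<turnstile> \<phi>"
  shows "gk_entails TYPE('w) T \<phi>"
proof -
  have "gk_eval W S e x \<phi> = 1"
    if "gk_model W S e" "x \<in> W" "\<forall>\<theta>\<in>T. gk_eval W S e x \<theta> = 1" for W :: "'w set" and S e x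
    using assms that
  proof (induction arbitrary: x rule: derivable.induct)
    case (MP T \<phi> \<psi>)
    then have "gk_eval W S e x \<phi> = 1" "gk_eval W S e x (\<phi> \<^bold>\<longrightarrow> \<psi>) = 1" by blast+
    then show ?case
      using gk_eval_unit[OF MP.prems(1,2), of \<psi>] by (simp add: goedel_imp_def split: if_splits)
  next
    case (BoxRule \<phi> T)
    \<comment> \<open>The premise is derived from the empty theory, so the induction hypothesis
      applies at every world and not only at \<open>x\<close>.\<close>
    then have "1 \<le> gk_eval W S e x (\<^bold>\<box> \<phi>)"
      by (subst gk_eval_box_ge) auto
    then show ?case using gk_eval_unit BoxRule.prems by (metis order.antisym)
  next
    case (DiaRule \<phi> \<psi> T)
    have mono: "gk_eval W S e y \<phi> \<le> gk_eval W S e y \<psi>" if "y \<in> W" for y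
      using DiaRule.IH[OF DiaRule.prems(1) that] gk_eval_unit[OF DiaRule.prems(1) that, of \<phi>]
      by (simp add: goedel_imp_eq_1)
    have "min (S x y) (gk_eval W S e y \<phi>) \<le> gk_eval W S e x (\<^bold>\<diamond> \<psi>)" if "y \<in> W" for y
    proof -
      have "min (S x y) (gk_eval W S e y \<psi>) \<le> gk_eval W S e x (\<^bold>\<diamond> \<psi>)"
        using gk_eval_dia_le[OF DiaRule.prems(1,2)] that by blast
      then show ?thesis using mono[OF that] by linarith
    qed
    then have "gk_eval W S e x (\<^bold>\<diamond> \<phi>) \<le> gk_eval W S e x (\<^bold>\<diamond> \<psi>)"
      using gk_eval_dia_le[OF DiaRule.prems(1,2)] by blast
    then show ?case by (simp add: goedel_imp_def)
  qed (simp_all add: goedel_axiom_sound modal_axiom_sound)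
  then show ?thesis by (simp add: gk_entails_def)
qed

subsection \<open>The lexicographic chain\<close>

definition binary_sum :: "(nat \<Rightarrow> bool) \<Rightarrow> real" where
  "binary_sum A = (\<Sum>n. (1/2) ^ Suc n * of_bool (A n))"

lemma binary_sum_summable: "summable (\<lambda>n. (1/2::real) ^ Suc n * of_bool (A n))"
proof (rule summable_comparison_test')
  show "summable (\<lambda>n. (1/2::real) ^ Suc n)"
    using power_half_series by (rule sums_summable)
  show "norm ((1/2::real) ^ Suc n * of_bool (A n)) \<le> (1/2) ^ Suc n" if "n \<ge> 0" for n
    by simp
qed

lemma binary_sum_mono: "(\<And>n. A n \<Longrightarrow> B n) \<Longrightarrow> binary_sum A \<le> binary_sum B"
  unfolding binary_sum_def by (intro suminf_le binary_sum_summable) auto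

lemma binary_sum_bounds: "0 \<le> binary_sum A" "binary_sum A \<le> 1"
proof -
  show "0 \<le> binary_sum A"
    unfolding binary_sum_def by (intro suminf_nonneg binary_sum_summable) auto
  have "binary_sum A \<le> binary_sum (\<lambda>_. True)" by (rule binary_sum_mono) simp
  also have "\<dots> = 1"
    unfolding binary_sum_def using sums_unique[OF power_half_series] by simp
  finally show "binary_sum A \<le> 1" .
qed

lemma binary_sum_True: "binary_sum (\<lambda>_. True) = 1"
  unfolding binary_sum_def using sums_unique[OF power_half_series] by simp

lemma binary_sum_False: "binary_sum (\<lambda>_. False) = 0"
  by (simp add: binary_sum_def)

text \<open>A chain of sets of natural numbers thus becomes a set of reals in the same order. In
  \<open>interpolation\<close> these are the sets of elements strictly below a given one, in
  \<open>unit_interval_embedding\<close> the sets of jumps below a given sequence.\<close>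

lemma binary_sum_strict:
  assumes "\<And>n. A n \<Longrightarrow> B n" "B m" "\<not> A m"
  shows "binary_sum A < binary_sum B"
proof -
  have "0 < (\<Sum>n. (1/2::real) ^ Suc n * of_bool (B n) - (1/2) ^ Suc n * of_bool (A n))"
    using assms by (intro suminf_pos2[where i = m] summable_diff binary_sum_summable) auto
  then show ?thesis
    unfolding binary_sum_def by (subst (asm) suminf_diff[symmetric]) (simp_all only: binary_sum_summable diff_gt_0_iff_gt)
qed

text \<open>The digits from \<open>N\<close> on weigh at most \<open>(1/2) ^ N\<close> together, so
  an upper estimate takes finitely many comparisons.\<close>

lemma binary_sum_tail:
  assumes "\<And>n. n < N \<Longrightarrow> B n \<Longrightarrow> A n"
  shows "binary_sum B \<le> binary_sum A + (1/2) ^ N"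
proof -
  have "binary_sum B = (\<Sum>n. (1/2) ^ Suc (n + N) * of_bool (B (n + N)))
      + (\<Sum>n<N. (1/2) ^ Suc n * of_bool (B n))"
    unfolding binary_sum_def by (rule suminf_split_initial_segment[OF binary_sum_summable])
  also have "(\<Sum>n. (1/2::real) ^ Suc (n + N) * of_bool (B (n + N))) = (1/2) ^ N * binary_sum (\<lambda>n. B (n + N))"
    unfolding binary_sum_def
    by (subst suminf_mult[OF binary_sum_summable, symmetric]) (simp add: power_add mult_ac)
  also have "\<dots> \<le> (1/2) ^ N"
    using binary_sum_bounds(2)[of "\<lambda>n. B (n + N)"] by simp
  also have "(\<Sum>n<N. (1/2::real) ^ Suc n * of_bool (B n)) \<le> (\<Sum>n<N. (1/2) ^ Suc n * of_bool (A n))"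
    using assms by (intro sum_mono) auto
  also have "\<dots> \<le> binary_sum A"
    unfolding binary_sum_def by (intro sum_le_suminf binary_sum_summable) auto
  finally show ?thesis by simp
qed

section \<open>Lexicographically ordered sequences of reals\<close>

datatype lexseq = Lexseq (coord: "nat \<Rightarrow> real")

definition agree :: "nat \<Rightarrow> lexseq \<Rightarrow> lexseq \<Rightarrow> bool" where
  "agree d p q \<longleftrightarrow> (\<forall>k<d. coord p k = coord q k)"

lemma agree_refl [simp]: "agree d p p"
  by (simp add: agree_def)

lemma agree_sym: "agree d p q \<Longrightarrow> agree d q p"
  by (simp add: agree_def)

lemma agree_trans: "agree d p q \<Longrightarrow> agree d q r \<Longrightarrow> agree d p r"
  by (simp add: agree_def)

lemma agree_mono: "agree d p q \<Longrightarrow> c \<le> d \<Longrightarrow> agree c p q"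
  by (simp add: agree_def)

text \<open>The sequences have a type of their own because functions already carry the pointwise
  order.\<close>

instantiation lexseq :: linorder
begin

definition less_lexseq :: "lexseq \<Rightarrow> lexseq \<Rightarrow> bool" where
  "(p::lexseq) < q \<longleftrightarrow> (\<exists>k. agree k p q \<and> coord p k < coord q k)"

definition less_eq_lexseq :: "lexseq \<Rightarrow> lexseq \<Rightarrow> bool" where
  "(p::lexseq) \<le> q \<longleftrightarrow> p = q \<or> p < q"

instance
proof -
  have irrefl: "\<not> p < p" for p :: lexseq
    by (simp add: less_lexseq_def)
  have trans: "p < r" if pq: "p < q" and qr: "q < r" for p q r :: lexseq
  proof -
    obtain j where j: "agree j p q" "coord p j < coord q j" using pq by (auto simp: less_lexseq_def)
    obtain k where k: "agree k q r" "coord q k < coord r k" using qr by (auto simp: less_lexseq_def)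
    have "agree (min j k) p r" using j k by (simp add: agree_def)
    moreover have "coord p (min j k) < coord r (min j k)"
      using j k by (cases j k rule: linorder_cases) (auto simp: agree_def)
    ultimately show ?thesis by (auto simp: less_lexseq_def)
  qed
  have total: "p < q \<or> p = q \<or> q < p" for p q :: lexseq
  proof (cases "p = q")
    case False
    define k where "k = (LEAST k. coord p k \<noteq> coord q k)"
    have "\<exists>k. coord p k \<noteq> coord q k" using False by (meson ext lexseq.expand)
    then have "coord p k \<noteq> coord q k" unfolding k_def by (rule LeastI_ex)
    moreover have "agree k p q" using not_less_Least unfolding k_def agree_def by blast
    ultimately show ?thesis
      using agree_sym unfolding less_lexseq_def by (metis linorder_less_linear)
  qed simp
  show "OFCLASS(lexseq, linorder_class)"
    by standard (unfold less_eq_lexseq_def, (metis irrefl trans total)+)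
qed

end

lemma lexseq_lessI: "agree k p q \<Longrightarrow> coord p k < coord q k \<Longrightarrow> p < q"
  by (auto simp: less_lexseq_def)

text \<open>The first coordinate at which \<open>p\<close> and \<open>q\<close> differ is below
  \<open>d\<close>, and up to there \<open>p'\<close> and \<open>q'\<close> have the same
  entries.\<close>

lemma less_agree:
  assumes "p < q" "\<not> agree d p q" "agree d p' p" "agree d q' q"
  shows "p' < q'"
proof -
  obtain k where k: "agree k p q" "coord p k < coord q k"
    using assms(1) by (auto simp: less_lexseq_def)
  then have "k < d" using assms(2) unfolding agree_def by (meson leI less_le_trans)
  then show ?thesis
    using k assms(3,4) by (intro lexseq_lessI[of k]) (auto simp: agree_def)
qed

text \<open>Were \<open>p < q\<close> decided before coordinate \<open>d\<close>, it would persist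
  with \<open>r\<close> in place of \<open>p\<close>, giving \<open>r < q\<close>. This will trap a
  value between that of a box and a nearby label.\<close>

lemma agree_between:
  assumes "p \<le> q" "q \<le> r" "agree d p r"
  shows "agree d p q"
  using assms less_agree[of p q d r r] by (metis agree_refl agree_sym leD less_agree nless_le)

definition unit_seqs :: "lexseq set" where
  "unit_seqs = {p. \<forall>k. 0 \<le> coord p k \<and> coord p k \<le> 1}"

text \<open>The padding \<open>1/2\<close> is an inner point of the unit interval, so that
  coordinate \<open>d\<close> can later be moved both up and down.\<close>

definition level :: "nat \<Rightarrow> lexseq set" where
  "level d = {p \<in> unit_seqs. \<forall>k\<ge>d. coord p k = 1/2}"

text \<open>The endpoints are not the extreme unit sequences: the padding keeps them in
  \<open>level 1\<close>, and the part of the chain that a model uses lies between them.\<close>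

definition lex_bot :: lexseq where
  "lex_bot = Lexseq (\<lambda>k. if k = 0 then 0 else 1/2)"

definition lex_top :: lexseq where
  "lex_top = Lexseq (\<lambda>k. if k = 0 then 1 else 1/2)"

lemma level_mono: "p \<in> level c \<Longrightarrow> c \<le> d \<Longrightarrow> p \<in> level d"
  by (auto simp: level_def)

lemma level_coord: "p \<in> level d \<Longrightarrow> d \<le> k \<Longrightarrow> coord p k = 1/2"
  by (auto simp: level_def)

lemma lex_bot_level: "0 < d \<Longrightarrow> lex_bot \<in> level d"
  and lex_top_level: "0 < d \<Longrightarrow> lex_top \<in> level d"
  by (auto simp: level_def unit_seqs_def lex_bot_def lex_top_def)

lemma lex_bot_less_top: "lex_bot < lex_top"
  by (rule lexseq_lessI[of 0]) (auto simp: agree_def lex_bot_def lex_top_def)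

lemma level_agree_eq:
  assumes "p \<in> level d" "q \<in> level d" "agree d p q"
  shows "p = q"
proof (rule lexseq.expand, rule ext)
  show "coord p k = coord q k" for k
    using assms by (cases "k < d") (auto simp: agree_def level_coord)
qed

section \<open>Lexicographic suprema\<close>

primrec lex_face :: "lexseq set \<Rightarrow> nat \<Rightarrow> lexseq set" where
  "lex_face A 0 = A"
| "lex_face A (Suc k) = {p \<in> lex_face A k. coord p k =
    (if lex_face A k = {} then 0 else SUP q\<in>lex_face A k. coord q k)}"

text \<open>Each coordinate is a supremum over those members of \<open>A\<close> that share all
  earlier ones. When none is left, the remaining entries are \<open>0\<close>, the least possible,
  which keeps the supremum least.\<close>

definition lex_Sup :: "lexseq set \<Rightarrow> lexseq" where
  "lex_Sup A = Lexseq (\<lambda>k. if lex_face A k = {} then 0 else SUP q\<in>lex_face A k. coord q k)"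

lemma lex_face_iff: "p \<in> lex_face A k \<longleftrightarrow> p \<in> A \<and> agree k p (lex_Sup A)"
proof (induction k)
  case (Suc k)
  then show ?case by (auto simp: agree_def lex_Sup_def less_Suc_eq)
qed (simp add: agree_def)

lemma bdd_above_lex_face:
  assumes "A \<subseteq> unit_seqs"
  shows "bdd_above ((\<lambda>q. coord q k) ` lex_face A k)"
  using assms by (intro bdd_aboveI[where M = 1]) (auto simp: unit_seqs_def lex_face_iff)

lemma lex_Sup_upper:
  assumes "A \<subseteq> unit_seqs" "p \<in> A"
  shows "p \<le> lex_Sup A"
proof (rule ccontr)
  assume "\<not> p \<le> lex_Sup A"
  then obtain k where k: "agree k (lex_Sup A) p" "coord (lex_Sup A) k < coord p k"
    by (auto simp: less_lexseq_def not_le)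
  then have p: "p \<in> lex_face A k" using assms(2) agree_sym by (auto simp: lex_face_iff)
  have "coord p k \<le> (SUP q\<in>lex_face A k. coord q k)"
    using p bdd_above_lex_face[OF assms(1)] by (rule cSUP_upper)
  also have "\<dots> = coord (lex_Sup A) k"
    using p by (auto simp: lex_Sup_def)
  finally show False using k by simp
qed

lemma lex_Sup_least:
  assumes "A \<subseteq> unit_seqs" "u \<in> unit_seqs" "\<And>p. p \<in> A \<Longrightarrow> p \<le> u"
  shows "lex_Sup A \<le> u"
proof (rule ccontr)
  assume "\<not> lex_Sup A \<le> u"
  then obtain k where k: "agree k u (lex_Sup A)" "coord u k < coord (lex_Sup A) k"
    by (auto simp: less_lexseq_def not_le)
  have "0 \<le> coord u k" using assms(2) by (auto simp: unit_seqs_def)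
  \<comment> \<open>The entry of the supremum exceeds \<open>coord u k\<close> and is thus positive,
    so it is not the default \<open>0\<close> of an empty face.\<close>
  then have ne: "lex_face A k \<noteq> {}"
    using k(2) by (auto simp: lex_Sup_def)
  then have "coord u k < (SUP q\<in>lex_face A k. coord q k)"
    using k(2) by (simp add: lex_Sup_def)
  then obtain p where p: "p \<in> lex_face A k" "coord u k < coord p k"
    using less_cSUP_iff[OF ne bdd_above_lex_face[OF assms(1)]] by blast
  then have "agree k u p"
    using k(1) agree_trans agree_sym by (metis lex_face_iff)
  then have "u < p" using p(2) by (rule lexseq_lessI)
  then show False using assms(3) p(1) by (metis lex_face_iff leD)
qed

lemma lex_Sup_unit:
  assumes "A \<subseteq> unit_seqs"
  shows "lex_Sup A \<in> unit_seqs"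
proof -
  have "0 \<le> (SUP q\<in>lex_face A k. coord q k) \<and> (SUP q\<in>lex_face A k. coord q k) \<le> 1"
    if ne: "lex_face A k \<noteq> {}" for k
  proof -
    obtain p where p: "p \<in> lex_face A k" using ne by blast
    have u: "0 \<le> coord q k \<and> coord q k \<le> 1" if "q \<in> lex_face A k" for q
      using that assms by (auto simp: unit_seqs_def lex_face_iff)
    have "coord p k \<le> (SUP q\<in>lex_face A k. coord q k)"
      using p bdd_above_lex_face[OF assms] by (rule cSUP_upper)
    moreover have "(SUP q\<in>lex_face A k. coord q k) \<le> 1"
      using ne u by (intro cSUP_least) auto
    ultimately show ?thesis using u[OF p] by linarith
  qed
  then show ?thesis by (auto simp: unit_seqs_def lex_Sup_def)
qed

section \<open>Changing a single coordinate, and interpolation\<close>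

definition bump :: "nat \<Rightarrow> real \<Rightarrow> lexseq \<Rightarrow> lexseq" where
  "bump d c p = Lexseq (\<lambda>k. if k < d then coord p k else if k = d then c else 1/2)"

lemma bump_agree: "agree d (bump d c p) p" "agree d p (bump d c p)"
  by (auto simp: bump_def agree_def)

lemma bump_level: "p \<in> unit_seqs \<Longrightarrow> 0 \<le> c \<Longrightarrow> c \<le> 1 \<Longrightarrow> bump d c p \<in> level (Suc d)"
  by (auto simp: bump_def level_def unit_seqs_def)

lemma bump_eqI: "p \<in> level d \<Longrightarrow> agree d p q \<Longrightarrow> bump d (1/2) q = p"
  by (rule lexseq.expand) (auto simp: bump_def agree_def level_coord fun_eq_iff)

lemma less_bumpI:
  assumes "p \<le> q" "coord p d < c"
  shows "p < bump d c q"
proof (cases "agree d p q")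
  case True
  then show ?thesis
    using assms(2) by (intro lexseq_lessI[of d]) (auto simp: bump_def agree_def)
next
  case False
  then have "p < q" using assms(1) by (auto simp: le_less)
  then show ?thesis using False less_agree bump_agree agree_refl by blast
qed

lemma bump_lessI:
  assumes "p \<le> q" "c < coord q d"
  shows "bump d c p < q"
proof (cases "agree d p q")
  case True
  then show ?thesis
    using assms(2) by (intro lexseq_lessI[of d]) (auto simp: bump_def agree_def)
next
  case False
  then have "p < q" using assms(1) by (auto simp: le_less)
  then show ?thesis using False less_agree bump_agree agree_refl by blast
qed

text \<open>Distinct members of \<open>level d\<close> differ before coordinate \<open>d\<close>,
  where the bump changes nothing. With \<open>c = 1\<close>, it lies in the gap between
  \<open>p\<close> and all greater members of \<open>level d\<close>.\<close>

lemma bump_less_levels: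
  assumes "p \<in> level d" "q \<in> level d" "p < q"
  shows "bump d c p < q"
  using less_agree[of p q d "bump d c p" q] assms level_agree_eq bump_agree agree_refl by blast

text \<open>Pairs in \<open>L\<close> and \<open>U\<close> are lower and upper bounds for the values of a linear preorder.
  The value of \<open>a\<close> begins with the first \<open>d\<close> coordinates of the supremum of its lower bounds.
  Coordinate \<open>d\<close>, at which all the bounds are \<open>1/2\<close>, then leaves room to put the elements that
  share these coordinates in order, above or below the one bound that may begin with them.\<close>

lemma interpolation:
  fixes le :: "'a \<Rightarrow> 'a \<Rightarrow> bool" and L U :: "(lexseq \<times> 'a) set"
  assumes "countable F"
    and refl: "\<And>a. le a a" and trans: "\<And>a b c. le a b \<Longrightarrow> le b c \<Longrightarrow> le a c"
    and total: "\<And>a b. le a b \<or> le b a"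
    and L: "\<And>p a. (p, a) \<in> L \<Longrightarrow> p \<in> level d" and U: "\<And>p a. (p, a) \<in> U \<Longrightarrow> p \<in> level d"
    and LU: "\<And>p a q b. (p, a) \<in> L \<Longrightarrow> (q, b) \<in> U \<Longrightarrow> le a b \<Longrightarrow> p \<le> q"
    and LU': "\<And>p a q b. (p, a) \<in> L \<Longrightarrow> (q, b) \<in> U \<Longrightarrow> q \<le> p \<Longrightarrow> le b a"
  obtains g where "\<And>a. g a \<in> level (Suc d)"
    "\<And>p a. (p, a) \<in> L \<Longrightarrow> p \<le> g a" "\<And>q a. (q, a) \<in> U \<Longrightarrow> g a \<le> q"
    "\<And>a b. a \<in> F \<Longrightarrow> b \<in> F \<Longrightarrow> g a \<le> g b \<longleftrightarrow> le a b"
    "\<And>a r. r \<in> level d \<Longrightarrow> (\<And>p b. (p, b) \<in> L \<Longrightarrow> le b a \<Longrightarrow> p \<le> r) \<Longrightarrow> g a < bump d 1 r"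
    "\<And>a r. r \<in> level d \<Longrightarrow> (\<And>p b. (p, b) \<in> L \<Longrightarrow> le b a \<Longrightarrow> p < r) \<Longrightarrow> g a < r"
proof -
  define below where "below a = {p. \<exists>b. (p, b) \<in> L \<and> le b a}" for a
  define above where "above a = {q. \<exists>b. (q, b) \<in> U \<and> le a b}" for a
  define l where "l a = lex_Sup (below a)" for a
  \<comment> \<open>Only a bound that begins with the first \<open>d\<close> coordinates of
    \<open>l a\<close> still constrains coordinate \<open>d\<close>; for all others the order is
    decided earlier.\<close>
  define low where "low a \<longleftrightarrow> (\<exists>p\<in>below a. agree d p (l a))" for a
  define upp where "upp a \<longleftrightarrow> (\<exists>q\<in>above a. agree d q (l a))" for a
  define h where "h a = binary_sum (\<lambda>n. \<not> le a (from_nat_into F n))" for a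
  \<comment> \<open>With bounds of both kinds, the value has to be their common value, whose entry
    is \<open>1/2\<close>. Otherwise it goes strictly above \<open>1/2\<close> if there is such a
    lower bound and strictly below if not; \<open>h a / 8\<close> orders the elements inside either
    range, and \<open>1\<close> is never reached.\<close>
  define c where "c a = (if low a then if upp a then 1/2 else 3/4 + h a / 8 else 1/4 + h a / 8)" for a
  define g where "g a = bump d (c a) (l a)" for a
  have h: "0 \<le> h a" "h a \<le> 1" for a
    by (simp_all add: h_def binary_sum_bounds)
  have c: "0 \<le> c a" "c a < 1" for a
    using h[of a] by (auto simp: c_def)
  have below_level: "below a \<subseteq> level d" and above_level: "above a \<subseteq> level d" for a
    using L U by (auto simp: below_def above_def)
  then have below_unit: "below a \<subseteq> unit_seqs" and above_unit: "above a \<subseteq> unit_seqs" for a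
    by (auto simp: level_def)
  have below_le: "p \<le> l a" if "p \<in> below a" for p a
    unfolding l_def using below_unit that by (rule lex_Sup_upper)
  have le_above: "l a \<le> q" if "q \<in> above a" for q a
    unfolding l_def
  proof (rule lex_Sup_least[OF below_unit])
    show "q \<in> unit_seqs" using that above_unit by blast
    show "p \<le> q" if "p \<in> below a" for p
      using that \<open>q \<in> above a\<close> LU trans unfolding below_def above_def by blast
  qed
  have low_le: "p \<le> g a" if "p \<in> below a" for p a
  proof (cases "agree d p (l a)")
    case True
    then have low: "low a" using that by (auto simp: low_def)
    have pd: "p \<in> level d" using that below_level by blast
    show ?thesis
    proof (cases "upp a")
      case True
      then have "g a = p"
        using low pd \<open>agree d p (l a)\<close> by (simp add: g_def c_def bump_eqI)
      then show ?thesis by simp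
    next
      case False
      then have "coord p d < c a"
        using low h[of a] level_coord[OF pd order.refl] by (simp add: c_def)
      then show ?thesis
        unfolding g_def using below_le[OF that] less_bumpI by (metis less_imp_le)
    qed
  next
    case False
    then show ?thesis
      unfolding g_def using below_le[OF that] less_agree bump_agree agree_refl
      by (metis le_less)
  qed
  have upp_ge: "g a \<le> q" if "q \<in> above a" for q a
  proof (cases "agree d q (l a)")
    case True
    then have upp: "upp a" using that by (auto simp: upp_def)
    have qd: "q \<in> level d" using that above_level by blast
    show ?thesis
    proof (cases "low a")
      case True
      then have "g a = q"
        using upp qd \<open>agree d q (l a)\<close> by (simp add: g_def c_def bump_eqI)
      then show ?thesis by simp
    next
      case False
      then have "c a < coord q d"
        using h[of a] level_coord[OF qd order.refl] by (simp add: c_def)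
      then show ?thesis
        unfolding g_def using le_above[OF that] bump_lessI by (metis less_imp_le)
    qed
  next
    case False
    then show ?thesis
      unfolding g_def using le_above[OF that] less_agree bump_agree agree_refl agree_sym
      by (metis le_less)
  qed
  have below_mono: "below a \<subseteq> below b" and above_mono: "above b \<subseteq> above a" if "le a b" for a b
    using that trans unfolding below_def above_def by blast+
  have equiv: "g a = g b" if "le a b" "le b a" for a b
  proof -
    have "below a = below b" "above a = above b"
      using that below_mono above_mono by blast+
    moreover have "h a = h b"
      using that trans unfolding h_def by (metis (lifting))
    ultimately show ?thesis
      by (simp add: g_def c_def low_def upp_def l_def)
  qed
  have strict: "g a < g b" if "b \<in> F" "a \<in> F" "\<not> le b a" for a b
  proof -
    have ab: "le a b" using that total by blast
    obtain m where m: "from_nat_into F m = a"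
      using \<open>a \<in> F\<close> \<open>countable F\<close> by (meson from_nat_into_surj)
    \<comment> \<open>The index \<open>m\<close> of \<open>a\<close> makes the difference:
      \<open>a\<close> is strictly below \<open>b\<close> but not strictly below itself.\<close>
    have hab: "h a < h b"
      unfolding h_def by (rule binary_sum_strict[of _ _ m]) (use ab trans refl that m in blast)+
    have "l a \<le> l b"
      unfolding l_def by (metis lex_Sup_least lex_Sup_unit lex_Sup_upper below_mono[OF ab] below_unit subsetD)
    show ?thesis
    proof (cases "agree d (l a) (l b)")
      case False
      then have "l a < l b" using \<open>l a \<le> l b\<close> by (auto simp: le_less)
      then show ?thesis
        unfolding g_def using False bump_agree(1) bump_agree(1) by (rule less_agree)
    next
      case True
      have low: "low b" if "low a"
        using that True below_mono[OF ab] agree_trans unfolding low_def by blast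
      have upp: "upp a" if "upp b"
        using that True above_mono[OF ab] agree_trans agree_sym unfolding upp_def by blast
      \<comment> \<open>Such a lower bound of \<open>a\<close> and such an upper bound of
        \<open>b\<close> would coincide, and \<open>LU'\<close> would give \<open>le b a\<close>.
        This excludes that \<open>a\<close> and \<open>b\<close> both receive the entry
        \<open>1/2\<close>.\<close>
      have not_both: "\<not> (low a \<and> upp b)"
      proof
        assume "low a \<and> upp b"
        then obtain p q where pq: "p \<in> below a" "q \<in> above b" "agree d p (l a)" "agree d q (l b)"
          by (auto simp: low_def upp_def)
        then have "p = q"
          using True agree_trans agree_sym below_level above_level level_agree_eq by (metis subsetD)
        then have "le b a"
          using pq(1,2) LU' trans unfolding below_def above_def by blast
        then show False using that by blast
      qed
      have "c a < c b"
        using low upp not_both hab h[of a] h[of b] by (auto simp: c_def)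
      then show ?thesis
        unfolding g_def using True by (intro lexseq_lessI[of d]) (auto simp: agree_def bump_def)
    qed
  qed
  show thesis
  proof (rule that[of g])
    show "g a \<in> level (Suc d)" for a
      unfolding g_def using c[of a] lex_Sup_unit[OF below_unit]
      by (intro bump_level) (auto simp: l_def)
    show "p \<le> g a" if "(p, a) \<in> L" for p a
      using that refl by (intro low_le) (auto simp: below_def)
    show "g a \<le> q" if "(q, a) \<in> U" for q a
      using that refl by (intro upp_ge) (auto simp: above_def)
    show "g a \<le> g b \<longleftrightarrow> le a b" if "a \<in> F" "b \<in> F" for a b
      using that strict equiv total by (metis leD le_less)
    show "g a < bump d 1 r"
      if r: "r \<in> level d" and le: "\<And>p b. (p, b) \<in> L \<Longrightarrow> le b a \<Longrightarrow> p \<le> r" for a r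
    proof -
      have "l a \<le> r"
        unfolding l_def using r le
        by (intro lex_Sup_least[OF below_unit]) (auto simp: level_def below_def)
      then have "g a \<le> bump d (c a) r \<or> g a < bump d 1 r"
        unfolding g_def
        by (cases "agree d (l a) r")
          (auto simp: le_less intro!: less_agree[of "l a" r d] lexseq.expand bump_agree simp: bump_def agree_def fun_eq_iff)
      moreover have "bump d (c a) r < bump d 1 r"
        using c[of a] by (intro lexseq_lessI[of d]) (auto simp: agree_def bump_def)
      ultimately show ?thesis by auto
    qed
    show "g a < r"
      if r: "r \<in> level d" and less: "\<And>p b. (p, b) \<in> L \<Longrightarrow> le b a \<Longrightarrow> p < r" for a r
    proof (cases "agree d (l a) r")
      case False
      moreover have "l a \<le> r"
        unfolding l_def using r less
        by (intro lex_Sup_least[OF below_unit]) (auto simp: level_def below_def less_imp_le)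
      ultimately show ?thesis
        unfolding g_def using less_agree[of "l a" r d] bump_agree by (metis agree_refl le_less)
    next
      case True
      \<comment> \<open>A lower bound with the prefix of \<open>r\<close> would be \<open>r\<close>
        itself, against strictness. Hence \<open>c a\<close> is below \<open>1/2\<close>, the entry
        of \<open>r\<close>.\<close>
      have "\<not> low a"
      proof
        assume "low a"
        then obtain p where "p \<in> below a" "agree d p (l a)" by (auto simp: low_def)
        then have "p = r" using True r below_level level_agree_eq agree_trans by (metis subsetD)
        then show False using \<open>p \<in> below a\<close> less by (auto simp: below_def)
      qed
      then have "c a < coord r d"
        using h[of a] level_coord[OF r order.refl] by (simp add: c_def)
      then show ?thesis
        unfolding g_def using True by (intro lexseq_lessI[of d]) (auto simp: agree_def bump_def)
    qed
  qed
qed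

text \<open>The jumps of \<open>f\<close> are placed at sequences ending in \<open>1, 1, \<dots>\<close>. None of them is in \<open>D\<close>,
  which makes \<open>f\<close> continuous at the members of \<open>D\<close>.\<close>

lemma unit_interval_embedding:
  assumes "countable D" "D \<subseteq> (\<Union>d. level d)" "lex_bot \<in> D" "lex_top \<in> D"
    and bounds: "\<And>p. p \<in> D \<Longrightarrow> lex_bot \<le> p" "\<And>p. p \<in> D \<Longrightarrow> p \<le> lex_top"
  obtains f :: "lexseq \<Rightarrow> real" where "strict_mono_on D f" "f lex_bot = 0" "f lex_top = 1"
    "\<And>p. 0 \<le> f p" "\<And>p. f p \<le> 1"
    "\<And>p \<epsilon>. p \<in> D \<Longrightarrow> \<epsilon> > 0 \<Longrightarrow> \<exists>m. \<forall>q. agree m p q \<longrightarrow> f q \<le> f p + \<epsilon>"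
proof -
  \<comment> \<open>Continued by ones, the cut-off sequence is greater than \<open>p\<close> in
    \<open>D\<close>, yet smaller than any \<open>q\<close> that first differs from \<open>p\<close>
    before coordinate \<open>d\<close> and is greater there.\<close>
  define cap where "cap p d = Lexseq (\<lambda>k. if k < d then coord p k else 1)" for p d
  \<comment> \<open>The restriction puts every jump below \<open>lex_top\<close>, so that
    \<open>f lex_top = 1\<close>.\<close>
  define E where "E = {e \<in> (\<Union>p\<in>D. range (cap p)). e < lex_top}"
  have "countable E"
    unfolding E_def using assms(1) by (intro countable_Collect countable_UN) auto
  have cap_agree: "agree d p (cap p d)" for p d
    by (simp add: agree_def cap_def)
  have less_cap: "p < cap p d" if "p \<in> D" for p d
  proof -
    obtain c where c: "p \<in> level c" using \<open>p \<in> D\<close> assms(2) by blast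
    \<comment> \<open>Such a coordinate exists because \<open>p\<close> is eventually
      \<open>1/2\<close>; it is the first at which \<open>p\<close> and \<open>cap p d\<close>
      differ.\<close>
    define k where "k = (LEAST k. d \<le> k \<and> coord p k < 1)"
    have "d \<le> max c d \<and> coord p (max c d) < 1" using level_coord[OF c, of "max c d"] by simp
    then have k: "d \<le> k" "coord p k < 1" unfolding k_def using LeastI by (metis (lifting))+
    have "agree k p (cap p d)"
    proof (unfold agree_def, intro allI impI)
      fix j assume "j < k"
      then have "\<not> (d \<le> j \<and> coord p j < 1)" unfolding k_def by (rule not_less_Least)
      moreover have "coord p j \<le> 1" using c by (auto simp: level_def unit_seqs_def)
      ultimately show "coord p j = coord (cap p d) j" by (auto simp: cap_def)
    qed
    then show ?thesis using k by (intro lexseq_lessI[of k]) (auto simp: cap_def)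
  qed
  have E_D: "e \<notin> D" if e: "e \<in> E" for e
  proof
    assume "e \<in> D"
    then obtain c where "e \<in> level c" using assms(2) by blast
    moreover obtain p d where "e = cap p d" using e by (auto simp: E_def)
    ultimately have "coord (cap p d) (max c d) = 1/2" using level_coord[of e c "max c d"] by simp
    then show False by (simp add: cap_def)
  qed
  have E_dense: "\<exists>e\<in>E. p < e \<and> e < q" if "p \<in> D" "q \<in> D" "p < q" for p q
  proof -
    obtain k where k: "agree k p q" "coord p k < coord q k"
      using \<open>p < q\<close> by (auto simp: less_lexseq_def)
    have "cap p (Suc k) < q"
      using k by (intro lexseq_lessI[of k]) (auto simp: agree_def cap_def)
    moreover from this have "cap p (Suc k) \<in> E"
      using that bounds(2)[of q] by (auto simp: E_def)
    ultimately show ?thesis using less_cap that by blast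
  qed
  have "E \<noteq> {}" using E_dense assms(3,4) lex_bot_less_top by blast
  then have enum: "from_nat_into E n \<in> E" for n by (rule from_nat_into)
  define f where "f q = binary_sum (\<lambda>n. from_nat_into E n < q)" for q
  show thesis
  proof (rule that[of f])
    show "strict_mono_on D f"
    proof (rule strict_mono_onI)
      fix p q assume pq: "p \<in> D" "q \<in> D" "p < q"
      then obtain e where e: "e \<in> E" "p < e" "e < q" using E_dense by blast
      then obtain m where m: "from_nat_into E m = e" using \<open>countable E\<close> by (meson from_nat_into_surj)
      show "f p < f q"
        unfolding f_def by (rule binary_sum_strict[of _ _ m]) (use pq e m in auto)
    qed
    have "lex_bot < e" if "e \<in> E" for e
      using that less_cap bounds(1) unfolding E_def by (auto intro: le_less_trans)
    then have "\<not> from_nat_into E n < lex_bot" for n using enum[of n] by (meson less_asym)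
    then show "f lex_bot = 0" by (simp add: f_def binary_sum_False)
    have "from_nat_into E n < lex_top" for n using enum[of n] by (simp add: E_def)
    then show "f lex_top = 1" by (simp add: f_def binary_sum_True)
    show "0 \<le> f p" "f p \<le> 1" for p by (simp_all add: f_def binary_sum_bounds)
    show "\<exists>m. \<forall>q. agree m p q \<longrightarrow> f q \<le> f p + \<epsilon>" if "p \<in> D" "\<epsilon> > 0" for p and \<epsilon> :: real
    proof -
      obtain N where N: "(1/2) ^ N < \<epsilon>" using \<open>\<epsilon> > 0\<close> real_arch_pow_inv[of \<epsilon> "1/2"] by auto
      \<comment> \<open>A sequence that shares enough coordinates with \<open>p\<close> does not
        pass a jump at \<open>e\<close> unless \<open>p\<close> does; \<open>e = p\<close> cannot
        occur, since \<open>E\<close> avoids \<open>D\<close>.\<close>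
      have "\<exists>k. \<forall>q. agree k p q \<longrightarrow> e < q \<longrightarrow> e < p" if "e \<in> E" for e
      proof (cases "p < e")
        case True
        then obtain k where k: "agree k p e" "coord p k < coord e k" by (auto simp: less_lexseq_def)
        have "q < e" if "agree (Suc k) p q" for q
          using that k by (intro lexseq_lessI[of k]) (auto simp: agree_def)
        then show ?thesis by (meson less_asym)
      next
        case False
        then have "e < p" using E_D \<open>p \<in> D\<close> \<open>e \<in> E\<close> by (metis linorder_less_linear)
        then show ?thesis by blast
      qed
      then have "\<forall>n. \<exists>k. \<forall>q. agree k p q \<longrightarrow> from_nat_into E n < q \<longrightarrow> from_nat_into E n < p"
        using enum by blast
      then obtain k where k: "\<And>n q. agree (k n) p q \<Longrightarrow> from_nat_into E n < q \<Longrightarrow> from_nat_into E n < p"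
        by (metis (no_types) choice)
      \<comment> \<open>Only the first \<open>N\<close> terms need control, because all later ones
        add at most \<open>(1/2) ^ N\<close>, which is less than \<epsilon>.\<close>
      define m where "m = Max (k ` {..<N})"
      have "f q \<le> f p + \<epsilon>" if "agree m p q" for q
      proof -
        have "f q \<le> f p + (1/2) ^ N"
          unfolding f_def
        proof (rule binary_sum_tail)
          fix n assume "n < N" "from_nat_into E n < q"
          moreover have "k n \<le> m" unfolding m_def using \<open>n < N\<close> by (intro Max_ge) auto
          ultimately show "from_nat_into E n < p" using k that agree_mono by blast
        qed
        then show ?thesis using N by linarith
      qed
      then show ?thesis by blast
    qed
  qed
qed

subsection \<open>Successor worlds\<close>

primrec subformulas :: "'v form \<Rightarrow> 'v form set" where
  "subformulas (Atom p) = {Atom p}"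
| "subformulas \<^bold>\<bottom> = {\<^bold>\<bottom>}"
| "subformulas (\<phi> \<^bold>\<and> \<psi>) = insert (\<phi> \<^bold>\<and> \<psi>) (subformulas \<phi> \<union> subformulas \<psi>)"
| "subformulas (\<phi> \<^bold>\<or> \<psi>) = insert (\<phi> \<^bold>\<or> \<psi>) (subformulas \<phi> \<union> subformulas \<psi>)"
| "subformulas (\<phi> \<^bold>\<longrightarrow> \<psi>) = insert (\<phi> \<^bold>\<longrightarrow> \<psi>) (subformulas \<phi> \<union> subformulas \<psi>)"
| "subformulas (\<^bold>\<box> \<phi>) = insert (\<^bold>\<box> \<phi>) (subformulas \<phi>)"
| "subformulas (\<^bold>\<diamond> \<phi>) = insert (\<^bold>\<diamond> \<phi>) (subformulas \<phi>)"

lemma finite_subformulas: "finite (subformulas \<phi>)"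
  by (induction \<phi>) auto

lemma subformulas_refl: "\<phi> \<in> subformulas \<phi>"
  by (cases \<phi>) auto

lemma subformulas_trans: "\<psi> \<in> subformulas \<phi> \<Longrightarrow> subformulas \<psi> \<subseteq> subformulas \<phi>"
  by (induction \<phi>) auto

text \<open>There may be uncountably many variables, so values are prescribed on a countable set of
  formulas only. It contains \<bottom> to anchor the least value.\<close>

locale fragment =
  fixes F :: "'v form set"
  assumes countable_F: "countable F"
    and falsum_F: "\<^bold>\<bottom> \<in> F"
    and subformulas_F: "\<phi> \<in> F \<Longrightarrow> subformulas \<phi> \<subseteq> F"
begin

text \<open>The depth \<open>d\<close> bounds the coordinates that the values at a world depend on,
  which leaves coordinate \<open>d\<close> free for building successors.\<close>

definition realizes :: "'v form set \<Rightarrow> ('v form \<Rightarrow> lexseq) \<Rightarrow> nat \<Rightarrow> bool" where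
  "realizes P x d \<longleftrightarrow> prime_theory P \<and> 0 < d \<and> x \<^bold>\<bottom> = lex_bot \<and>
    (\<forall>\<psi>\<in>F. x \<psi> \<in> level d \<and> x \<psi> \<le> lex_top \<and> (x \<psi> = lex_top \<longleftrightarrow> \<psi> \<in> P)) \<and>
    (\<forall>\<psi>\<in>F. \<forall>\<chi>\<in>F. x \<psi> \<le> x \<chi> \<longleftrightarrow> \<psi> \<^bold>\<longrightarrow> \<chi> \<in> P)"

text \<open>The members of \<open>Q\<close> form the greatest class of the preorder, so raising them
  to \<open>lex_top\<close> keeps \<open>g\<close> an embedding as long as all other values are
  below \<open>lex_top\<close>.\<close>

lemma realizesI:
  assumes "prime_theory Q" "0 < d" "\<And>\<psi>. g \<psi> \<in> level d" "g \<^bold>\<bottom> = lex_bot"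
    and emb: "\<And>\<psi> \<chi>. \<psi> \<in> F \<Longrightarrow> \<chi> \<in> F \<Longrightarrow> g \<psi> \<le> g \<chi> \<longleftrightarrow> \<psi> \<^bold>\<longrightarrow> \<chi> \<in> Q"
    and less_top: "\<And>\<psi>. \<psi> \<in> F \<Longrightarrow> \<psi> \<notin> Q \<Longrightarrow> g \<psi> < lex_top"
  shows "realizes Q (\<lambda>\<psi>. if \<psi> \<in> Q then lex_top else g \<psi>) d"
proof -
  interpret Q: prime_theory Q by fact
  have "(if \<psi> \<in> Q then lex_top else g \<psi>) \<le> (if \<chi> \<in> Q then lex_top else g \<chi>) \<longleftrightarrow> \<psi> \<^bold>\<longrightarrow> \<chi> \<in> Q"
    if "\<psi> \<in> F" "\<chi> \<in> F" for \<psi> \<chi>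
  proof -
    have "\<psi> \<^bold>\<longrightarrow> \<chi> \<notin> Q" if "\<psi> \<in> Q" "\<chi> \<notin> Q" using that Q.mp by blast
    moreover have "\<psi> \<^bold>\<longrightarrow> \<chi> \<in> Q" if "\<chi> \<in> Q" using that by (rule Q.imp_mem)
    ultimately show ?thesis
      using that emb[OF that] less_top[OF that(1)] less_top[OF that(2)] by (auto simp: not_le)
  qed
  moreover have "(if \<psi> \<in> Q then lex_top else g \<psi>) \<le> lex_top \<and>
      ((if \<psi> \<in> Q then lex_top else g \<psi>) = lex_top \<longleftrightarrow> \<psi> \<in> Q)" if "\<psi> \<in> F" for \<psi>
    using less_top[OF that] by auto
  ultimately show ?thesis
    unfolding realizes_def using assms(1-4) Q.consistent lex_top_level by auto
qed

text \<open>These are the conditions of \<open>gk_eval_box_ge\<close> and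
  \<open>gk_eval_dia_le\<close> at one successor, stated in the chain of sequences.\<close>

definition edge :: "('v form \<Rightarrow> lexseq) \<Rightarrow> lexseq \<Rightarrow> ('v form \<Rightarrow> lexseq) \<Rightarrow> bool" where
  "edge x s y \<longleftrightarrow> (\<forall>\<psi>. \<^bold>\<box> \<psi> \<in> F \<longrightarrow> min (x (\<^bold>\<box> \<psi>)) s \<le> y \<psi>) \<and>
    (\<forall>\<psi>. \<^bold>\<diamond> \<psi> \<in> F \<longrightarrow> min s (y \<psi>) \<le> x (\<^bold>\<diamond> \<psi>))"

text \<open>\<open>B\<close> contains the formulas with a value below the label of the new edge, the only ones that
  impose an upper bound through a diamond.\<close>

lemma realizes_extension:
  assumes x: "realizes P x d" and "d \<le> n" and "prime_theory Q"
    and box: "\<And>\<psi>. \<^bold>\<box> \<psi> \<in> P \<Longrightarrow> \<psi> \<in> Q"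
    and dia: "\<And>\<psi> b. b \<in> B \<Longrightarrow> \<^bold>\<diamond> \<psi> \<^bold>\<longrightarrow> b \<in> P \<Longrightarrow> \<psi> \<notin> Q"
    and "\<^bold>\<bottom> \<in> B" and r: "r \<in> level n" "r \<le> lex_top"
    and bound: "(r < lex_top \<and> (\<forall>a\<in>F. \<forall>\<psi>. \<psi> \<notin> Q \<longrightarrow> a \<^bold>\<longrightarrow> \<^bold>\<box> \<psi> \<in> P \<longrightarrow> x a \<le> r)) \<or>
      (\<forall>a\<in>F. \<forall>\<psi>. \<psi> \<notin> Q \<longrightarrow> a \<^bold>\<longrightarrow> \<^bold>\<box> \<psi> \<in> P \<longrightarrow> x a < r)"
  obtains y where "realizes Q y (Suc n)"
    "\<And>\<psi>. \<^bold>\<box> \<psi> \<in> F \<Longrightarrow> x (\<^bold>\<box> \<psi>) \<le> y \<psi>"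
    "\<And>\<psi>. \<^bold>\<diamond> \<psi> \<in> F \<Longrightarrow> \<^bold>\<diamond> \<psi> \<in> B \<Longrightarrow> y \<psi> \<le> x (\<^bold>\<diamond> \<psi>)"
    "\<And>\<psi>. \<psi> \<notin> Q \<Longrightarrow> y \<psi> < bump n 1 r"
proof -
  interpret P: prime_theory P using x by (simp add: realizes_def)
  interpret Q: prime_theory Q by fact
  have x_bot: "x \<^bold>\<bottom> = lex_bot" and "0 < d"
    and x_level: "\<And>\<psi>. \<psi> \<in> F \<Longrightarrow> x \<psi> \<in> level n"
    and x_top: "\<And>\<psi>. \<psi> \<in> F \<Longrightarrow> x \<psi> \<le> lex_top"
    and x_le: "\<And>\<psi> \<chi>. \<psi> \<in> F \<Longrightarrow> \<chi> \<in> F \<Longrightarrow> x \<psi> \<le> x \<chi> \<longleftrightarrow> \<psi> \<^bold>\<longrightarrow> \<chi> \<in> P"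
    using x level_mono[OF _ \<open>d \<le> n\<close>] by (auto simp: realizes_def)
  \<comment> \<open>The bounds are values of formulas \<open>a\<close> and \<open>b\<close> from
    \<open>F\<close>, because \<psi> is arbitrary and its box and diamond may lie outside
    \<open>F\<close>. Members of \<open>Q\<close> receive no lower bound, being raised to
    \<open>lex_top\<close> in the end.\<close>
  define L where "L = {(x a, \<psi>) | a \<psi>. a \<in> F \<and> \<psi> \<notin> Q \<and> a \<^bold>\<longrightarrow> \<^bold>\<box> \<psi> \<in> P}"
  define U where "U = {(x b, \<psi>) | b \<psi>. b \<in> F \<and> b \<in> B \<and> \<^bold>\<diamond> \<psi> \<^bold>\<longrightarrow> b \<in> P}"
  \<comment> \<open>Otherwise \<open>b\<close> is strictly below \<open>a\<close>, so
    \<open>\<box>\<psi>\<close> is strictly above \<open>\<diamond>\<chi>\<close> and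
    \<open>\<box>\<psi> \<longrightarrow> \<diamond>\<chi>\<close> has the value of its consequent.
    Then \<open>DiaImp\<close> puts \<open>\<diamond>(\<psi> \<longrightarrow> \<chi>)\<close> below
    \<open>b\<close>, and \<open>dia\<close> keeps \<open>\<psi> \<longrightarrow> \<chi>\<close>
    out of \<open>Q\<close>.\<close>
  have LU: "p \<le> q" if L: "(p, \<psi>) \<in> L" and U: "(q, \<chi>) \<in> U" and le: "\<psi> \<^bold>\<longrightarrow> \<chi> \<in> Q" for p q \<psi> \<chi>
  proof (rule ccontr)
    assume "\<not> p \<le> q"
    obtain a where a: "p = x a" "a \<in> F" "a \<^bold>\<longrightarrow> \<^bold>\<box> \<psi> \<in> P" using L by (auto simp: L_def)
    obtain b where b: "q = x b" "b \<in> F" "b \<in> B" "\<^bold>\<diamond> \<chi> \<^bold>\<longrightarrow> b \<in> P" using U by (auto simp: U_def)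
    have "a \<^bold>\<longrightarrow> b \<notin> P" using \<open>\<not> p \<le> q\<close> a b x_le by blast
    moreover have "\<^bold>\<box> \<psi> \<^bold>\<longrightarrow> \<^bold>\<diamond> \<chi> \<in> P \<Longrightarrow> a \<^bold>\<longrightarrow> b \<in> P" using a b P.imp_trans by blast
    ultimately have *: "\<^bold>\<box> \<psi> \<^bold>\<longrightarrow> \<^bold>\<diamond> \<chi> \<notin> P" by blast
    have "\<^bold>\<diamond> (\<psi> \<^bold>\<longrightarrow> \<chi>) \<^bold>\<longrightarrow> b \<in> P"
      by (meson * DiaImp P.imp_consequent P.imp_trans P.modal_mem b(4))
    then show False using dia b(3) le by blast
  qed
  \<comment> \<open>Here \<open>\<diamond>\<chi>\<close> is below \<open>\<box>\<psi>\<close>, so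
    \<open>DiaBox\<close> makes \<open>\<box>(\<chi> \<longrightarrow> \<psi>)\<close> true and
    \<open>box\<close> transfers its body to \<open>Q\<close>.\<close>
  have UL: "\<chi> \<^bold>\<longrightarrow> \<psi> \<in> Q" if L: "(p, \<psi>) \<in> L" and U: "(q, \<chi>) \<in> U" and le: "q \<le> p" for p q \<psi> \<chi>
  proof -
    obtain a where a: "p = x a" "a \<in> F" "a \<^bold>\<longrightarrow> \<^bold>\<box> \<psi> \<in> P" using L by (auto simp: L_def)
    obtain b where b: "q = x b" "b \<in> F" "\<^bold>\<diamond> \<chi> \<^bold>\<longrightarrow> b \<in> P" using U by (auto simp: U_def)
    have "b \<^bold>\<longrightarrow> a \<in> P" using le a b x_le by blast
    then have "\<^bold>\<diamond> \<chi> \<^bold>\<longrightarrow> \<^bold>\<box> \<psi> \<in> P" using a b P.imp_trans by blast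
    then show ?thesis using P.box_imp box by blast
  qed
  have L_level: "p \<in> level n" if "(p, \<psi>) \<in> L" for p \<psi>
    using that x_level by (auto simp: L_def)
  have U_level: "p \<in> level n" if "(p, \<psi>) \<in> U" for p \<psi>
    using that x_level by (auto simp: U_def)
  obtain g where g_level: "\<And>\<psi>. g \<psi> \<in> level (Suc n)"
    and g_L: "\<And>p \<psi>. (p, \<psi>) \<in> L \<Longrightarrow> p \<le> g \<psi>"
    and g_U: "\<And>q \<psi>. (q, \<psi>) \<in> U \<Longrightarrow> g \<psi> \<le> q"
    and g_le: "\<And>\<psi> \<chi>. \<psi> \<in> F \<Longrightarrow> \<chi> \<in> F \<Longrightarrow> g \<psi> \<le> g \<chi> \<longleftrightarrow> \<psi> \<^bold>\<longrightarrow> \<chi> \<in> Q"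
    and g_bump: "\<And>\<psi> r. r \<in> level n \<Longrightarrow>
      (\<And>p \<chi>. (p, \<chi>) \<in> L \<Longrightarrow> \<chi> \<^bold>\<longrightarrow> \<psi> \<in> Q \<Longrightarrow> p \<le> r) \<Longrightarrow> g \<psi> < bump n 1 r"
    and g_less: "\<And>\<psi> r. r \<in> level n \<Longrightarrow>
      (\<And>p \<chi>. (p, \<chi>) \<in> L \<Longrightarrow> \<chi> \<^bold>\<longrightarrow> \<psi> \<in> Q \<Longrightarrow> p < r) \<Longrightarrow> g \<psi> < r"
  proof (rule interpolation[of F "\<lambda>\<psi> \<chi>. \<psi> \<^bold>\<longrightarrow> \<chi> \<in> Q" L n U], goal_cases)
    case (9 g)
    show thesis by (rule 9(1)[OF 9(2-)])
  qed (rule countable_F Q.imp_refl Q.imp_total | erule L_level U_level | erule (1) Q.imp_trans |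
      erule (2) LU UL)+
  have L_r: "p \<le> r" if "(p, \<chi>) \<in> L" for p \<chi>
    using that bound by (auto simp: L_def less_imp_le)
  have bump: "g \<psi> < bump n 1 r" for \<psi>
    using r(1) L_r by (rule g_bump)
  \<comment> \<open>The first alternative of \<open>bound\<close> is for box successors: the gap
    above \<open>r\<close> still ends below \<open>lex_top\<close>. The second is for diamond
    successors, where \<open>r\<close> may be \<open>lex_top\<close> itself.\<close>
  have less_top: "g \<psi> < lex_top" for \<psi>
    using bound
  proof
    assume "r < lex_top \<and> (\<forall>a\<in>F. \<forall>\<psi>. \<psi> \<notin> Q \<longrightarrow> a \<^bold>\<longrightarrow> \<^bold>\<box> \<psi> \<in> P \<longrightarrow> x a \<le> r)"
    then have "bump n 1 r < lex_top"
      using r(1) lex_top_level \<open>0 < d\<close> \<open>d \<le> n\<close> by (intro bump_less_levels) auto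
    then show ?thesis using bump less_trans by blast
  next
    assume *: "\<forall>a\<in>F. \<forall>\<psi>. \<psi> \<notin> Q \<longrightarrow> a \<^bold>\<longrightarrow> \<^bold>\<box> \<psi> \<in> P \<longrightarrow> x a < r"
    have "g \<psi> < r"
      using r(1) by (rule g_less) (use * in \<open>auto simp: L_def\<close>)
    then show ?thesis using r(2) by simp
  qed
  \<comment> \<open>Bounds of \<open>lex_bot\<close> on both sides pin the value of
    \<bottom>.\<close>
  have "(lex_bot, \<^bold>\<bottom>) \<in> L"
    unfolding L_def using falsum_F x_bot Q.consistent P.falsum_imp by force
  moreover have "(lex_bot, \<^bold>\<bottom>) \<in> U"
    unfolding U_def using falsum_F x_bot \<open>\<^bold>\<bottom> \<in> B\<close> P.modal_mem[OF DiaFalsum] by force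
  ultimately have g_bot: "g \<^bold>\<bottom> = lex_bot" using g_L g_U by (meson order.antisym)
  define y where "y = (\<lambda>\<psi>. if \<psi> \<in> Q then lex_top else g \<psi>)"
  show thesis
  proof (rule that)
    show "realizes Q y (Suc n)"
      unfolding y_def using \<open>prime_theory Q\<close> g_level g_bot g_le less_top by (intro realizesI) auto
    show "x (\<^bold>\<box> \<psi>) \<le> y \<psi>" if "\<^bold>\<box> \<psi> \<in> F" for \<psi>
    proof (cases "\<psi> \<in> Q")
      case False
      then have "(x (\<^bold>\<box> \<psi>), \<psi>) \<in> L" using that P.imp_refl by (auto simp: L_def)
      then show ?thesis using g_L False by (simp add: y_def)
    qed (simp add: y_def x_top that)
    show "y \<psi> \<le> x (\<^bold>\<diamond> \<psi>)" if "\<^bold>\<diamond> \<psi> \<in> F" "\<^bold>\<diamond> \<psi> \<in> B" for \<psi>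
    proof -
      have "\<psi> \<notin> Q" using dia that P.imp_refl by blast
      moreover have "(x (\<^bold>\<diamond> \<psi>), \<psi>) \<in> U" using that P.imp_refl by (auto simp: U_def)
      ultimately show ?thesis using g_U by (simp add: y_def)
    qed
    show "y \<psi> < bump n 1 r" if "\<psi> \<notin> Q" for \<psi>
      using that bump by (simp add: y_def)
  qed
qed

definition label :: "lexseq \<Rightarrow> bool" where
  "label s \<longleftrightarrow> s \<in> (\<Union>d. level d) \<and> lex_bot \<le> s \<and> s \<le> lex_top"

definition realizable :: "('v form \<Rightarrow> lexseq) \<Rightarrow> bool" where
  "realizable x \<longleftrightarrow> (\<exists>P d. realizes P x d)"

lemma realizable_label:
  assumes "realizable x" "\<psi> \<in> F"
  shows "label (x \<psi>)"
proof -
  obtain P d where P: "realizes P x d" using assms(1) by (auto simp: realizable_def)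
  then interpret prime_theory P by (simp add: realizes_def)
  have "x \<^bold>\<bottom> \<le> x \<psi>" "x \<^bold>\<bottom> = lex_bot" "x \<psi> \<le> lex_top" "x \<psi> \<in> level d"
    using P falsum_imp falsum_F assms(2) by (auto simp: realizes_def)
  then show ?thesis by (auto simp: label_def)
qed

lemma label_bot: "label lex_bot" and label_top: "label lex_top"
  using lex_bot_level[of 1] lex_top_level[of 1] lex_bot_less_top by (auto simp: label_def)

text \<open>The label \<open>s\<close> lies in the gap just above the value \<open>r\<close> of
  \<open>\<box>\<phi>\<close>. Diamonds with a value above \<open>r\<close> also exceed
  \<open>s\<close> and impose nothing, while \<open>y \<phi> < s\<close> makes
  \<open>y \<phi>\<close> the contribution of this edge to the infimum. Lying between
  \<open>r\<close> and \<open>s\<close>, it shares \<open>m\<close> coordinates with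
  \<open>r\<close>.\<close>

lemma box_step:
  assumes x: "realizable x" and F: "\<^bold>\<box> \<phi> \<in> F" and "x (\<^bold>\<box> \<phi>) \<noteq> lex_top"
  obtains y s where "realizable y" "label s" "edge x s y" "y \<phi> < s" "agree m (x (\<^bold>\<box> \<phi>)) s"
proof -
  obtain P d where P: "realizes P x d" using x by (auto simp: realizable_def)
  then interpret P: prime_theory P by (simp add: realizes_def)
  define n where "n = max d m"
  define r where "r = x (\<^bold>\<box> \<phi>)"
  define s where "s = bump n 1 r"
  have "d \<le> n" "m \<le> n" by (auto simp: n_def)
  have "0 < n" using P \<open>d \<le> n\<close> by (auto simp: realizes_def)
  have x_level: "\<And>\<psi>. \<psi> \<in> F \<Longrightarrow> x \<psi> \<in> level n"
    and x_le: "\<And>\<psi> \<chi>. \<psi> \<in> F \<Longrightarrow> \<chi> \<in> F \<Longrightarrow> x \<psi> \<le> x \<chi> \<longleftrightarrow> \<psi> \<^bold>\<longrightarrow> \<chi> \<in> P"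
    using P level_mono[OF _ \<open>d \<le> n\<close>] by (auto simp: realizes_def)
  have r: "r \<in> level n" "r < lex_top" "\<^bold>\<box> \<phi> \<notin> P"
    using P F assms(3) x_level[OF F] by (auto simp: realizes_def r_def)
  obtain Q where Q: "prime_theory Q" "\<phi> \<notin> Q"
    "\<And>\<psi>. \<psi> \<notin> Q \<Longrightarrow> \<^bold>\<box> \<psi> \<^bold>\<longrightarrow> \<^bold>\<box> \<phi> \<in> P"
    "\<And>\<psi>. \<^bold>\<box> \<psi> \<in> P \<Longrightarrow> \<psi> \<in> Q"
    "\<And>\<psi>. \<^bold>\<diamond> \<psi> \<^bold>\<longrightarrow> \<^bold>\<box> \<phi> \<in> P \<Longrightarrow> \<psi> \<notin> Q"
    using P.box_successor[OF r(3)] by blast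
  obtain y where y: "realizes Q y (Suc n)"
    "\<And>\<psi>. \<^bold>\<box> \<psi> \<in> F \<Longrightarrow> x (\<^bold>\<box> \<psi>) \<le> y \<psi>"
    "\<And>\<psi>. \<^bold>\<diamond> \<psi> \<in> F \<Longrightarrow> \<^bold>\<diamond> \<psi> \<in> {b. b \<^bold>\<longrightarrow> \<^bold>\<box> \<phi> \<in> P} \<Longrightarrow> y \<psi> \<le> x (\<^bold>\<diamond> \<psi>)"
    "\<And>\<psi>. \<psi> \<notin> Q \<Longrightarrow> y \<psi> < bump n 1 r"
  proof (rule realizes_extension[OF P \<open>d \<le> n\<close> Q(1,4), where B = "{b. b \<^bold>\<longrightarrow> \<^bold>\<box> \<phi> \<in> P}" and r = r])
    show "\<psi> \<notin> Q" if "b \<in> {b. b \<^bold>\<longrightarrow> \<^bold>\<box> \<phi> \<in> P}" "\<^bold>\<diamond> \<psi> \<^bold>\<longrightarrow> b \<in> P" for b \<psi>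
      using that Q(5) P.imp_trans by blast
    show "\<^bold>\<bottom> \<in> {b. b \<^bold>\<longrightarrow> \<^bold>\<box> \<phi> \<in> P}" using P.falsum_imp by blast
    show "r < lex_top \<and> (\<forall>a\<in>F. \<forall>\<psi>. \<psi> \<notin> Q \<longrightarrow> a \<^bold>\<longrightarrow> \<^bold>\<box> \<psi> \<in> P \<longrightarrow> x a \<le> r) \<or>
      (\<forall>a\<in>F. \<forall>\<psi>. \<psi> \<notin> Q \<longrightarrow> a \<^bold>\<longrightarrow> \<^bold>\<box> \<psi> \<in> P \<longrightarrow> x a < r)"
    proof (intro disjI1 conjI ballI allI impI)
      show "x a \<le> r" if "a \<in> F" "\<psi> \<notin> Q" "a \<^bold>\<longrightarrow> \<^bold>\<box> \<psi> \<in> P" for a \<psi>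
        using P.imp_trans[OF that(3) Q(3)[OF that(2)]] x_le[OF that(1) F] by (simp add: r_def)
    qed (rule r(2))
  qed (use r in auto)
  have s_less: "s < u" if "u \<in> level n" "r < u" for u
    unfolding s_def using r(1) that by (rule bump_less_levels)
  have "r < s"
    unfolding s_def using level_coord[OF r(1) order.refl] by (intro less_bumpI) auto
  show thesis
  proof (rule that)
    show "realizable y" using y(1) by (auto simp: realizable_def)
    have "lex_bot \<le> r" using realizable_label[OF x F] by (auto simp: label_def r_def)
    moreover have "s < lex_top" using s_less lex_top_level \<open>0 < n\<close> r(2) by blast
    moreover have "s \<in> level (Suc n)"
      unfolding s_def using r(1) by (intro bump_level) (auto simp: level_def)
    ultimately show "label s" using \<open>r < s\<close> by (auto simp: label_def)
    have "min s (y \<psi>) \<le> x (\<^bold>\<diamond> \<psi>)" if "\<^bold>\<diamond> \<psi> \<in> F" for \<psi>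
    proof (cases "\<^bold>\<diamond> \<psi> \<^bold>\<longrightarrow> \<^bold>\<box> \<phi> \<in> P")
      case True
      then show ?thesis using y(3) that by (simp add: min_le_iff_disj)
    next
      case False
      then have "r < x (\<^bold>\<diamond> \<psi>)" using x_le that F by (auto simp: r_def not_le[symmetric])
      then show ?thesis using s_less x_level[OF that] by (simp add: min_le_iff_disj less_imp_le)
    qed
    then show "edge x s y" using y(2) by (simp add: edge_def min_le_iff_disj)
    show "y \<phi> < s" using y(4) Q(2) by (simp add: s_def)
    show "agree m (x (\<^bold>\<box> \<phi>)) s"
      using bump_agree(2) \<open>m \<le> n\<close> agree_mono unfolding s_def r_def by blast
  qed
qed

text \<open>The label can be the value of \<open>\<diamond>\<phi>\<close> itself, so the supremum is
  attained. Only diamonds strictly below it impose upper bounds.\<close>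

lemma dia_step:
  assumes x: "realizable x" and F: "\<^bold>\<diamond> \<phi> \<in> F" and "x (\<^bold>\<diamond> \<phi>) \<noteq> lex_bot"
  obtains y where "realizable y" "edge x (x (\<^bold>\<diamond> \<phi>)) y" "y \<phi> = lex_top"
proof -
  obtain P d where P: "realizes P x d" using x by (auto simp: realizable_def)
  then interpret P: prime_theory P by (simp add: realizes_def)
  define r where "r = x (\<^bold>\<diamond> \<phi>)"
  have x_le: "\<And>\<psi> \<chi>. \<psi> \<in> F \<Longrightarrow> \<chi> \<in> F \<Longrightarrow> x \<psi> \<le> x \<chi> \<longleftrightarrow> \<psi> \<^bold>\<longrightarrow> \<chi> \<in> P"
    using P by (auto simp: realizes_def)
  have r: "r \<in> level d" "r \<le> lex_top"
    using P F by (auto simp: realizes_def r_def)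
  have "x \<^bold>\<bottom> = lex_bot" "lex_bot \<le> r"
    using P realizable_label[OF x F] by (auto simp: realizes_def label_def r_def)
  then have neg: "\<^bold>\<diamond> \<phi> \<^bold>\<longrightarrow> \<^bold>\<bottom> \<notin> P"
    using x_le[OF F falsum_F] assms(3) by (auto simp: r_def)
  obtain Q where Q: "prime_theory Q" "\<phi> \<in> Q"
    "\<And>\<psi>. \<^bold>\<diamond> \<phi> \<^bold>\<longrightarrow> \<^bold>\<box> \<psi> \<in> P \<Longrightarrow> \<psi> \<in> Q"
    "\<And>\<psi>. \<^bold>\<diamond> \<phi> \<^bold>\<longrightarrow> \<^bold>\<diamond> \<psi> \<notin> P \<Longrightarrow> \<psi> \<notin> Q"
    using P.dia_successor[OF neg] by blast
  obtain y where y: "realizes Q y (Suc d)"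
    "\<And>\<psi>. \<^bold>\<box> \<psi> \<in> F \<Longrightarrow> x (\<^bold>\<box> \<psi>) \<le> y \<psi>"
    "\<And>\<psi>. \<^bold>\<diamond> \<psi> \<in> F \<Longrightarrow> \<^bold>\<diamond> \<psi> \<in> {b. \<^bold>\<diamond> \<phi> \<^bold>\<longrightarrow> b \<notin> P} \<Longrightarrow> y \<psi> \<le> x (\<^bold>\<diamond> \<psi>)"
    "\<And>\<psi>. \<psi> \<notin> Q \<Longrightarrow> y \<psi> < bump d 1 r"
  proof (rule realizes_extension[OF P order.refl Q(1), where B = "{b. \<^bold>\<diamond> \<phi> \<^bold>\<longrightarrow> b \<notin> P}" and r = r])
    show "\<psi> \<in> Q" if "\<^bold>\<box> \<psi> \<in> P" for \<psi>
      using that Q(3) P.imp_mem by blast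
    show "\<psi> \<notin> Q" if "b \<in> {b. \<^bold>\<diamond> \<phi> \<^bold>\<longrightarrow> b \<notin> P}" "\<^bold>\<diamond> \<psi> \<^bold>\<longrightarrow> b \<in> P" for b \<psi>
      using that Q(4) P.imp_trans by blast
    show "\<^bold>\<bottom> \<in> {b. \<^bold>\<diamond> \<phi> \<^bold>\<longrightarrow> b \<notin> P}" using neg by blast
    \<comment> \<open>Were \<open>a\<close> at least as great as \<open>\<diamond>\<phi>\<close>,
      then \<open>\<diamond>\<phi>\<close> would be below \<open>\<box>\<psi>\<close>, which would
      put \<psi> into \<open>Q\<close>.\<close>
    have "x a < r" if "a \<in> F" "\<psi> \<notin> Q" "a \<^bold>\<longrightarrow> \<^bold>\<box> \<psi> \<in> P" for a \<psi>
      using that Q(3) P.imp_trans x_le F unfolding r_def by (meson not_le)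
    then show "r < lex_top \<and> (\<forall>a\<in>F. \<forall>\<psi>. \<psi> \<notin> Q \<longrightarrow> a \<^bold>\<longrightarrow> \<^bold>\<box> \<psi> \<in> P \<longrightarrow> x a \<le> r) \<or>
      (\<forall>a\<in>F. \<forall>\<psi>. \<psi> \<notin> Q \<longrightarrow> a \<^bold>\<longrightarrow> \<^bold>\<box> \<psi> \<in> P \<longrightarrow> x a < r)"
      by blast
  qed (use r in auto)
  show thesis
  proof (rule that)
    show "realizable y" using y(1) by (auto simp: realizable_def)
    have "min r (y \<psi>) \<le> x (\<^bold>\<diamond> \<psi>)" if "\<^bold>\<diamond> \<psi> \<in> F" for \<psi>
      using y(3)[OF that] x_le[OF F that] by (auto simp: min_le_iff_disj r_def)
    then show "edge x (x (\<^bold>\<diamond> \<phi>)) y" using y(2) by (simp add: edge_def min_le_iff_disj r_def)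
    have "\<phi> \<in> F" using subformulas_F[OF F] subformulas_refl by auto
    then show "y \<phi> = lex_top" using y(1) Q(2) by (simp add: realizes_def)
  qed
qed

text \<open>Covering both modalities and the vacuous cases, this lets the children of each world be
  indexed by all pairs of a formula and a precision \<open>m\<close>.\<close>

definition witness ::
  "('v form \<Rightarrow> lexseq) \<Rightarrow> 'v form \<Rightarrow> nat \<Rightarrow> ('v form \<Rightarrow> lexseq) \<Rightarrow> lexseq \<Rightarrow> bool" where
  "witness x \<theta> m y s \<longleftrightarrow> realizable y \<and> label s \<and> edge x s y \<and>
    (\<forall>\<phi>. \<theta> = \<^bold>\<box> \<phi> \<longrightarrow> \<theta> \<in> F \<longrightarrow> x \<theta> \<noteq> lex_top \<longrightarrow> y \<phi> < s \<and> agree m (x \<theta>) s) \<and>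
    (\<forall>\<phi>. \<theta> = \<^bold>\<diamond> \<phi> \<longrightarrow> \<theta> \<in> F \<longrightarrow> x \<theta> \<noteq> lex_bot \<longrightarrow> s = x \<theta> \<and> y \<phi> = lex_top)"

text \<open>When nothing has to be witnessed, the label \<open>lex_bot\<close> makes the edge conditions trivial.\<close>

lemma witness_exists:
  assumes x: "realizable x"
  shows "\<exists>y s. witness x \<theta> m y s"
proof -
  consider (1) \<phi> where "\<theta> = \<^bold>\<box> \<phi>" "\<theta> \<in> F" "x \<theta> \<noteq> lex_top"
    | (2) \<phi> where "\<theta> = \<^bold>\<diamond> \<phi>" "\<theta> \<in> F" "x \<theta> \<noteq> lex_bot"
    | (3) "\<forall>\<phi>. \<theta> = \<^bold>\<box> \<phi> \<longrightarrow> \<theta> \<in> F \<longrightarrow> x \<theta> = lex_top"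
      "\<forall>\<phi>. \<theta> = \<^bold>\<diamond> \<phi> \<longrightarrow> \<theta> \<in> F \<longrightarrow> x \<theta> = lex_bot"
    by blast
  then show ?thesis
  proof cases
    case 1
    then obtain y s where "realizable y" "label s" "edge x s y" "y \<phi> < s" "agree m (x \<theta>) s"
      using box_step[OF x] by metis
    then show ?thesis using 1 by (intro exI[of _ y] exI[of _ s]) (auto simp: witness_def)
  next
    case 2
    then obtain y where "realizable y" "edge x (x \<theta>) y" "y \<phi> = lex_top"
      using dia_step[OF x] by metis
    then show ?thesis
      using 2 realizable_label[OF x] by (intro exI[of _ y] exI[of _ "x \<theta>"]) (auto simp: witness_def)
  next
    case 3
    have "lex_bot \<le> x \<psi>" if "\<psi> \<in> F" for \<psi>
      using realizable_label[OF x that] by (simp add: label_def)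
    moreover have "\<psi> \<in> F" if "\<^bold>\<box> \<psi> \<in> F" for \<psi>
      using subformulas_F[OF that] subformulas_refl by auto
    ultimately have "edge x lex_bot x" by (simp add: edge_def min_le_iff_disj)
    then show ?thesis using x label_bot 3 unfolding witness_def by blast
  qed
qed

subsection \<open>The countermodel\<close>

text \<open>Interpolation with \<open>lex_bot\<close> as the lower and the upper bound of \<bottom>.
  All values then stay below \<open>bump 1 1 lex_bot\<close>, and so below
  \<open>lex_top\<close>.\<close>

lemma realizable_root:
  assumes "prime_theory P"
  obtains x where "realizable x" "\<And>\<psi>. \<psi> \<in> F \<Longrightarrow> x \<psi> = lex_top \<longleftrightarrow> \<psi> \<in> P"
proof -
  interpret prime_theory P by fact
  let ?L = "{(lex_bot, \<^bold>\<bottom> :: 'v form)}"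
  have L_level: "p \<in> level 1" if "(p, \<psi>) \<in> ?L" for p \<psi>
    using that lex_bot_level[of 1] by simp
  have LU: "p \<le> q" if "(p, \<psi>) \<in> ?L" "(q, \<chi>) \<in> ?L" "\<psi> \<^bold>\<longrightarrow> \<chi> \<in> P" for p q \<psi> \<chi>
    using that by simp
  have UL: "\<chi> \<^bold>\<longrightarrow> \<psi> \<in> P" if "(p, \<psi>) \<in> ?L" "(q, \<chi>) \<in> ?L" "q \<le> p" for p q \<psi> \<chi>
    using that imp_refl by simp
  obtain g where g: "\<And>\<psi>. g \<psi> \<in> level (Suc 1)"
    "\<And>p \<psi>. (p, \<psi>) \<in> ?L \<Longrightarrow> p \<le> g \<psi>"
    "\<And>p \<psi>. (p, \<psi>) \<in> ?L \<Longrightarrow> g \<psi> \<le> p"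
    "\<And>\<psi> \<chi>. \<psi> \<in> F \<Longrightarrow> \<chi> \<in> F \<Longrightarrow> g \<psi> \<le> g \<chi> \<longleftrightarrow> \<psi> \<^bold>\<longrightarrow> \<chi> \<in> P"
    "\<And>\<psi> r. r \<in> level 1 \<Longrightarrow>
      (\<And>p \<chi>. (p, \<chi>) \<in> ?L \<Longrightarrow> \<chi> \<^bold>\<longrightarrow> \<psi> \<in> P \<Longrightarrow> p \<le> r) \<Longrightarrow> g \<psi> < bump 1 1 r"
  proof (rule interpolation[of F "\<lambda>\<psi> \<chi>. \<psi> \<^bold>\<longrightarrow> \<chi> \<in> P" ?L 1 ?L], goal_cases)
    case (9 g)
    show thesis by (rule 9(1)[OF 9(2-6)])
  qed (rule countable_F imp_refl imp_total | erule L_level | erule (1) imp_trans | erule (2) LU UL)+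
  have "g \<psi> < lex_top" for \<psi>
  proof -
    have "g \<psi> < bump 1 1 lex_bot" using lex_bot_level[of 1] by (intro g(5)) auto
    also have "\<dots> < lex_top"
      using lex_bot_level lex_top_level lex_bot_less_top by (intro bump_less_levels) auto
    finally show ?thesis .
  qed
  moreover have "g \<^bold>\<bottom> = lex_bot" using g(2,3) by (intro order.antisym) auto
  ultimately have "realizes P (\<lambda>\<psi>. if \<psi> \<in> P then lex_top else g \<psi>) (Suc 1)"
    using g(1,4) by (intro realizesI \<open>prime_theory P\<close>) auto
  moreover from this have "\<And>\<psi>. \<psi> \<in> F \<Longrightarrow> (if \<psi> \<in> P then lex_top else g \<psi>) = lex_top \<longleftrightarrow> \<psi> \<in> P"
    unfolding realizes_def by blast
  ultimately show thesis using that unfolding realizable_def by blast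
qed

text \<open>In a chain, greatest lower and least upper bounds are minima and maxima. For
  implication, \<open>K\<close> and \<open>imp_consequent\<close> make
  \<open>\<phi> \<longrightarrow> \<psi>\<close> equivalent to \<psi> unless it is true.\<close>

lemma realizable_connectives:
  assumes "realizable x"
  shows "x \<^bold>\<bottom> = lex_bot"
    and "\<phi> \<^bold>\<and> \<psi> \<in> F \<Longrightarrow> x (\<phi> \<^bold>\<and> \<psi>) = min (x \<phi>) (x \<psi>)"
    and "\<phi> \<^bold>\<or> \<psi> \<in> F \<Longrightarrow> x (\<phi> \<^bold>\<or> \<psi>) = max (x \<phi>) (x \<psi>)"
    and "\<phi> \<^bold>\<longrightarrow> \<psi> \<in> F \<Longrightarrow> x (\<phi> \<^bold>\<longrightarrow> \<psi>) = (if x \<phi> \<le> x \<psi> then lex_top else x \<psi>)"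
proof -
  obtain P d where P: "realizes P x d" using assms(1) by (auto simp: realizable_def)
  then interpret prime_theory P by (simp add: realizes_def)
  have x_le: "\<And>\<psi> \<chi>. \<psi> \<in> F \<Longrightarrow> \<chi> \<in> F \<Longrightarrow> x \<psi> \<le> x \<chi> \<longleftrightarrow> \<psi> \<^bold>\<longrightarrow> \<chi> \<in> P"
    and x_top: "\<And>\<psi>. \<psi> \<in> F \<Longrightarrow> x \<psi> = lex_top \<longleftrightarrow> \<psi> \<in> P"
    using P by (auto simp: realizes_def)
  show "x \<^bold>\<bottom> = lex_bot" using P by (simp add: realizes_def)
  show "x (\<phi> \<^bold>\<and> \<psi>) = min (x \<phi>) (x \<psi>)" if F: "\<phi> \<^bold>\<and> \<psi> \<in> F"
  proof -
    have sub: "\<phi> \<in> F" "\<psi> \<in> F" using subformulas_F[OF F] subformulas_refl by auto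
    have "x (\<phi> \<^bold>\<and> \<psi>) \<le> x \<phi>" "x (\<phi> \<^bold>\<and> \<psi>) \<le> x \<psi>" using x_le F sub con_imp by blast+
    moreover have "x \<phi> \<le> x (\<phi> \<^bold>\<and> \<psi>)" if "x \<phi> \<le> x \<psi>"
      using that x_le F sub imp_con[OF imp_refl] by blast
    moreover have "x \<psi> \<le> x (\<phi> \<^bold>\<and> \<psi>)" if "x \<psi> \<le> x \<phi>"
      using that x_le F sub imp_con[OF _ imp_refl] by blast
    ultimately show ?thesis by (metis linear min_absorb1 min_absorb2 order.antisym)
  qed
  show "x (\<phi> \<^bold>\<or> \<psi>) = max (x \<phi>) (x \<psi>)" if F: "\<phi> \<^bold>\<or> \<psi> \<in> F"
  proof -
    have sub: "\<phi> \<in> F" "\<psi> \<in> F" using subformulas_F[OF F] subformulas_refl by auto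
    have "x \<phi> \<le> x (\<phi> \<^bold>\<or> \<psi>)" "x \<psi> \<le> x (\<phi> \<^bold>\<or> \<psi>)" using x_le F sub imp_dis by blast+
    moreover have "x (\<phi> \<^bold>\<or> \<psi>) \<le> x \<psi>" if "x \<phi> \<le> x \<psi>"
      using that x_le F sub dis_imp[OF _ imp_refl] by blast
    moreover have "x (\<phi> \<^bold>\<or> \<psi>) \<le> x \<phi>" if "x \<psi> \<le> x \<phi>"
      using that x_le F sub dis_imp[OF imp_refl] by blast
    ultimately show ?thesis by (metis linear max_absorb1 max_absorb2 order.antisym)
  qed
  show "x (\<phi> \<^bold>\<longrightarrow> \<psi>) = (if x \<phi> \<le> x \<psi> then lex_top else x \<psi>)" if F: "\<phi> \<^bold>\<longrightarrow> \<psi> \<in> F"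
  proof -
    have sub: "\<phi> \<in> F" "\<psi> \<in> F" using subformulas_F[OF F] subformulas_refl by auto
    have "x (\<phi> \<^bold>\<longrightarrow> \<psi>) \<le> x \<psi>" if "\<not> x \<phi> \<le> x \<psi>" using that x_le F sub imp_consequent by blast
    moreover have "\<psi> \<^bold>\<longrightarrow> (\<phi> \<^bold>\<longrightarrow> \<psi>) \<in> P" by (meson closed Goedel K)
    then have "x \<psi> \<le> x (\<phi> \<^bold>\<longrightarrow> \<psi>)" using x_le F sub by blast
    ultimately show ?thesis using x_top[OF F] x_le[OF sub] by auto
  qed
qed

lemma countermodel:
  assumes "prime_theory P"
  obtains S :: "(nat \<times> nat) list \<Rightarrow> (nat \<times> nat) list \<Rightarrow> real" and e
    where "gk_model UNIV S e" "\<And>\<psi>. \<psi> \<in> F \<Longrightarrow> gk_eval UNIV S e [] \<psi> = 1 \<longleftrightarrow> \<psi> \<in> P"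
proof -
  obtain x0 where x0: "realizable x0" "\<And>\<psi>. \<psi> \<in> F \<Longrightarrow> x0 \<psi> = lex_top \<longleftrightarrow> \<psi> \<in> P"
    using realizable_root[OF assms] by blast
  have "\<forall>x l. \<exists>y s. realizable x \<longrightarrow> witness x (from_nat_into F (fst l)) (snd l) y s"
    using witness_exists by blast
  then obtain child lab where "\<And>x l. realizable x \<Longrightarrow>
      witness x (from_nat_into F (fst l)) (snd l) (child x l) (lab x l)"
    unfolding choice_iff by blast
  note child = this[unfolded witness_def]
  \<comment> \<open>A world is a list of requests, the latest one first. A request consists of the
    index of a formula in \<open>F\<close> and a precision.\<close>
  define node where "node = (\<lambda>w. foldr (\<lambda>l x. child x l) w x0)"
  have node: "node [] = x0" "\<And>l w. node (l # w) = child (node w) l"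
    by (simp_all add: node_def)
  have real: "realizable (node w)" for w
    by (induction w) (use x0 child in \<open>auto simp: node\<close>)
  \<comment> \<open>All values and labels that occur; they are countably many, since both the lists
    of requests and \<open>F\<close> are countable.\<close>
  define D where "D = insert lex_bot (insert lex_top
    ((\<lambda>(w, \<psi>). node w \<psi>) ` (UNIV \<times> F) \<union> range (\<lambda>(w, l). lab (node w) l)))"
  have D_node: "node w \<psi> \<in> D" if "\<psi> \<in> F" for w \<psi> using that by (auto simp: D_def)
  have D_lab: "lab (node w) l \<in> D" for w l by (auto simp: D_def)
  have "label p" if "p \<in> D" for p
    using that label_bot label_top real realizable_label child unfolding D_def by fastforce
  then have D: "D \<subseteq> (\<Union>d. level d)" "\<And>p. p \<in> D \<Longrightarrow> lex_bot \<le> p" "\<And>p. p \<in> D \<Longrightarrow> p \<le> lex_top"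
    by (auto simp: label_def)
  have "countable D" unfolding D_def using countable_F by auto
  moreover have "lex_bot \<in> D" "lex_top \<in> D" by (auto simp: D_def)
  ultimately obtain f :: "lexseq \<Rightarrow> real" where mono: "strict_mono_on D f"
    and f_bot: "f lex_bot = 0" and f_top: "f lex_top = 1" and f_unit: "\<And>p. 0 \<le> f p" "\<And>p. f p \<le> 1"
    and f_approx: "\<And>p \<epsilon>. p \<in> D \<Longrightarrow> \<epsilon> > 0 \<Longrightarrow> \<exists>m. \<forall>q. agree m p q \<longrightarrow> f q \<le> f p + \<epsilon>"
    using unit_interval_embedding[OF _ D(1) _ _ D(2,3)] by metis
  have f_le: "f p \<le> f q \<longleftrightarrow> p \<le> q" if "p \<in> D" "q \<in> D" for p q
    using strict_mono_on_less_eq[OF mono that] .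
  have f_min: "f (min p q) = min (f p) (f q)" and f_max: "f (max p q) = max (f p) (f q)"
    if "p \<in> D" "q \<in> D" for p q
    using f_le[OF that] by (auto simp: min_def max_def)
  \<comment> \<open>Edges run only from a list to its extensions by one request. The label
    \<open>0\<close> makes all other pairs harmless for both modalities.\<close>
  define S where "S v u = (case u of [] \<Rightarrow> 0 | l # w \<Rightarrow> if w = v then f (lab (node v) l) else 0)"
    for v u
  have S_Cons: "S w (l # w) = f (lab (node w) l)" for w l by (simp add: S_def)
  have S_cases: "S v u = 0 \<or> (\<exists>l. u = l # v)" for v u by (auto simp: S_def split: list.split)
  define e where "e w p = f (node w (Atom p))" for w p
  have M: "gk_model UNIV S e"
    using f_unit by (auto simp: gk_model_def S_def e_def split: list.split)
  note u = gk_eval_unit[OF M UNIV_I]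
  have truth: "gk_eval UNIV S e w \<psi> = f (node w \<psi>)" if "\<psi> \<in> F" for \<psi> w
    using that
  proof (induction \<psi> arbitrary: w)
    case (Atom p)
    show ?case by (simp add: e_def)
  next
    case Falsum
    show ?case by (simp add: realizable_connectives(1)[OF real] f_bot)
  next
    case (Con \<phi> \<psi>)
    have "\<phi> \<in> F" "\<psi> \<in> F" using subformulas_F[OF Con.prems] subformulas_refl by auto
    then show ?case
      using Con.IH realizable_connectives(2)[OF real Con.prems] f_min D_node by simp
  next
    case (Dis \<phi> \<psi>)
    have "\<phi> \<in> F" "\<psi> \<in> F" using subformulas_F[OF Dis.prems] subformulas_refl by auto
    then show ?case
      using Dis.IH realizable_connectives(3)[OF real Dis.prems] f_max D_node by simp
  next
    case (Imp \<phi> \<psi>)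
    have "\<phi> \<in> F" "\<psi> \<in> F" using subformulas_F[OF Imp.prems] subformulas_refl by auto
    then show ?case
      using Imp.IH realizable_connectives(4)[OF real Imp.prems] f_le D_node f_top
      by (simp add: goedel_imp_def)
  next
    case (Box \<phi>)
    define r where "r = node w (\<^bold>\<box> \<phi>)"
    have "r \<in> D" using D_node Box.prems by (simp add: r_def)
    have \<phi>: "\<phi> \<in> F" using subformulas_F[OF Box.prems] subformulas_refl by auto
    have edge: "min r (lab (node w) l) \<le> node (l # w) \<phi>" for l
      using child[OF real, of w l] Box.prems by (simp add: edge_def node r_def)
    have "min (f r) (S w v) \<le> gk_eval UNIV S e v \<phi>" for v
      using S_cases[of w v]
    proof
      assume "S w v = 0"
      then show ?thesis using u[of v \<phi>] by (simp add: min_le_iff_disj)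
    next
      assume "\<exists>l. v = l # w"
      then obtain l where v: "v = l # w" by blast
      have "min r (lab (node w) l) \<in> D" using \<open>r \<in> D\<close> D_lab by (simp add: min_def)
      then show ?thesis
        unfolding v S_Cons Box.IH[OF \<phi>] f_min[OF \<open>r \<in> D\<close> D_lab, symmetric]
        using f_le D_node[OF \<phi>] edge by blast
    qed
    then have "f r \<le> gk_eval UNIV S e w (\<^bold>\<box> \<phi>)"
      using gk_eval_box_ge[OF M UNIV_I f_unit(2)] by blast
    moreover have "gk_eval UNIV S e w (\<^bold>\<box> \<phi>) \<le> f r"
    proof (cases "r = lex_top")
      case True
      then show ?thesis using u f_top by (simp del: gk_eval.simps)
    next
      case False
      show ?thesis
      proof (rule field_le_epsilon)
        fix \<epsilon> :: real assume "\<epsilon> > 0"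
        then obtain m where m: "\<And>q. agree m r q \<Longrightarrow> f q \<le> f r + \<epsilon>"
          using f_approx[OF \<open>r \<in> D\<close>] by blast
        obtain n where n: "from_nat_into F n = \<^bold>\<box> \<phi>"
          using Box.prems countable_F by (meson from_nat_into_surj)
        define y where "y = node ((n, m) # w) \<phi>"
        define s where "s = lab (node w) (n, m)"
        have ys: "y < s" "agree m r s"
          using child[OF real, of w "(n, m)"] Box.prems False n
          by (auto simp: y_def s_def node r_def)
        \<comment> \<open>As \<open>y\<close> lies between \<open>r\<close> and \<open>s\<close>, it
          shares \<open>m\<close> coordinates with \<open>r\<close>, so \<open>f y\<close> exceeds
          \<open>f r\<close> by at most \<epsilon>. Since also \<open>f y < f s\<close>, the infimum
          is at most \<open>f y\<close>.\<close>
        have "r \<le> y" using edge[of "(n, m)"] ys(1) by (auto simp: y_def s_def min_le_iff_disj)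
        then have "f y \<le> f r + \<epsilon>" using m agree_between[of r y s] ys by simp
        have "f y < f s"
          using strict_mono_onD[OF mono] D_node[OF \<phi>] D_lab ys(1) by (simp add: y_def s_def)
        have "min (gk_eval UNIV S e w (\<^bold>\<box> \<phi>)) (S w ((n, m) # w)) \<le> gk_eval UNIV S e ((n, m) # w) \<phi>"
          using gk_eval_box_ge[OF M UNIV_I, where r = "gk_eval UNIV S e w (\<^bold>\<box> \<phi>)"] u by blast
        then have "min (gk_eval UNIV S e w (\<^bold>\<box> \<phi>)) (f s) \<le> f y"
          unfolding S_Cons Box.IH[OF \<phi>] by (simp only: y_def s_def)
        then show "gk_eval UNIV S e w (\<^bold>\<box> \<phi>) \<le> f r + \<epsilon>"
          using \<open>f y < f s\<close> \<open>f y \<le> f r + \<epsilon>\<close> by linarith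
      qed
    qed
    ultimately show ?case unfolding r_def by (rule order.antisym[rotated])
  next
    case (Dia \<phi>)
    define r where "r = node w (\<^bold>\<diamond> \<phi>)"
    have "r \<in> D" using D_node Dia.prems by (simp add: r_def)
    have \<phi>: "\<phi> \<in> F" using subformulas_F[OF Dia.prems] subformulas_refl by auto
    have edge: "min (lab (node w) l) (node (l # w) \<phi>) \<le> r" for l
      using child[OF real, of w l] Dia.prems by (simp add: edge_def node r_def)
    have "min (S w v) (gk_eval UNIV S e v \<phi>) \<le> f r" for v
      using S_cases[of w v]
    proof
      assume "S w v = 0"
      then show ?thesis using f_unit by (simp add: min_le_iff_disj)
    next
      assume "\<exists>l. v = l # w"
      then obtain l where v: "v = l # w" by blast
      have "min (lab (node w) l) (node (l # w) \<phi>) \<in> D"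
        using D_node[OF \<phi>] D_lab by (simp add: min_def)
      then show ?thesis
        unfolding v S_Cons Dia.IH[OF \<phi>] f_min[OF D_lab D_node[OF \<phi>], symmetric]
        using f_le \<open>r \<in> D\<close> edge by blast
    qed
    then have "gk_eval UNIV S e w (\<^bold>\<diamond> \<phi>) \<le> f r"
      using gk_eval_dia_le[OF M UNIV_I] by blast
    moreover have "f r \<le> gk_eval UNIV S e w (\<^bold>\<diamond> \<phi>)"
    proof (cases "r = lex_bot")
      case True
      then show ?thesis using u f_bot by (simp del: gk_eval.simps)
    next
      case False
      obtain n where n: "from_nat_into F n = \<^bold>\<diamond> \<phi>"
        using Dia.prems countable_F by (meson from_nat_into_surj)
      \<comment> \<open>Any precision will do here, since the child attains the supremum.\<close>
      have "lab (node w) (n, 0) = r" "node ((n, 0) # w) \<phi> = lex_top"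
        using child[OF real, of w "(n, 0)"] Dia.prems False n
        by (auto simp: node r_def)
      moreover have "min (S w ((n, 0) # w)) (gk_eval UNIV S e ((n, 0) # w) \<phi>) \<le> gk_eval UNIV S e w (\<^bold>\<diamond> \<phi>)"
        using gk_eval_dia_le[OF M UNIV_I, where r = "gk_eval UNIV S e w (\<^bold>\<diamond> \<phi>)"] by blast
      ultimately show ?thesis
        unfolding S_Cons Dia.IH[OF \<phi>] using f_top f_unit(2) by (simp del: gk_eval.simps)
    qed
    ultimately show ?case unfolding r_def by (rule order.antisym)
  qed
  have "gk_eval UNIV S e [] \<psi> = 1 \<longleftrightarrow> \<psi> \<in> P" if "\<psi> \<in> F" for \<psi>
  proof -
    have "f (x0 \<psi>) = f lex_top \<longleftrightarrow> x0 \<psi> = lex_top"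
      using f_le D_node[OF that, of "[]"] \<open>lex_top \<in> D\<close> by (metis node(1) order.eq_iff)
    then show ?thesis using truth[OF that, of "[]"] x0(2)[OF that] by (simp add: node f_top)
  qed
  then show thesis using that M by blast
qed

end

section \<open>Moving the countermodel into an arbitrary infinite type\<close>

lemma gk_eval_image:
  "gk_eval (\<iota> ` W) S e (\<iota> x) \<phi> = gk_eval W (\<lambda>a b. S (\<iota> a) (\<iota> b)) (\<lambda>a. e (\<iota> a)) x \<phi>"
  by (induction \<phi> arbitrary: x) (simp_all add: image_image)

lemma gk_model_image:
  "gk_model (\<iota> ` W) S e \<longleftrightarrow> gk_model W (\<lambda>a b. S (\<iota> a) (\<iota> b)) (\<lambda>a. e (\<iota> a))"
  by (auto simp: gk_model_def)

text \<open>A countable type injects into every infinite type, and the copy of the model on the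
  image has the same values.\<close>

lemma gk_entails_countable:
  fixes W :: "'u::countable set"
  assumes "gk_entails TYPE('w) T \<phi>" "infinite (UNIV :: 'w set)"
    and "gk_model W S e" "x \<in> W" "\<forall>\<theta>\<in>T. gk_eval W S e x \<theta> = 1"
  shows "gk_eval W S e x \<phi> = 1"
proof -
  obtain j :: "nat \<Rightarrow> 'w" where "inj j"
    using infinite_countable_subset[OF assms(2)] by blast
  define \<iota> :: "'u \<Rightarrow> 'w" where "\<iota> = j \<circ> to_nat"
  have "inj \<iota>" unfolding \<iota>_def using \<open>inj j\<close> by (intro inj_compose) simp_all
  define S' where "S' a b = S (inv \<iota> a) (inv \<iota> b)" for a b
  define e' where "e' a = e (inv \<iota> a)" for a
  have S': "(\<lambda>a b. S' (\<iota> a) (\<iota> b)) = S" and e': "(\<lambda>a. e' (\<iota> a)) = e"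
    by (simp_all add: S'_def e'_def \<open>inj \<iota>\<close>)
  have "gk_model (\<iota> ` W) S' e'"
    using assms(3) unfolding gk_model_image S' e' .
  moreover have eval: "gk_eval (\<iota> ` W) S' e' (\<iota> x) \<theta> = gk_eval W S e x \<theta>" for \<theta>
    unfolding gk_eval_image S' e' ..
  ultimately show ?thesis
    using assms(1,4,5) unfolding gk_entails_def by (metis image_eqI)
qed

theorem theorem3p1:
  fixes T :: "'v form set" and \<phi> :: "'v form"
  assumes "countable T"
    and "infinite (UNIV :: 'w set)"
  shows "T \<turnstile> \<phi> \<longleftrightarrow> gk_entails TYPE('w) T \<phi>"
proof
  assume entails: "gk_entails TYPE('w) T \<phi>"
  show "T \<turnstile> \<phi>"
  proof (rule ccontr)
    assume "\<not> T \<turnstile> \<phi>"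
    \<comment> \<open>This makes the singleton of \<phi> closed under disjunction in the sense of
      \<open>prime_extension\<close>.\<close>
    moreover have "{} \<turnstile> (\<phi> \<^bold>\<or> \<phi>) \<^bold>\<longrightarrow> \<phi>"
      by (meson DisE Goedel MP derivable_imp_refl)
    ultimately obtain P where P: "prime_theory P" "T \<subseteq> P" "\<phi> \<notin> P"
      using prime_extension[of "{\<phi>}" T] by auto
    define F where "F = (\<Union>\<psi>\<in>insert \<^bold>\<bottom> (insert \<phi> T). subformulas \<psi>)"
    have "insert \<phi> T \<subseteq> F" unfolding F_def using subformulas_refl by fastforce
    interpret fragment F
    proof
      show "countable F"
        unfolding F_def using assms(1) finite_subformulas
        by (intro countable_UN) (auto intro: countable_finite)
      show "\<^bold>\<bottom> \<in> F" by (simp add: F_def)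
      show "subformulas \<psi> \<subseteq> F" if "\<psi> \<in> F" for \<psi>
        using that subformulas_trans unfolding F_def by blast
    qed
    obtain S :: "(nat \<times> nat) list \<Rightarrow> (nat \<times> nat) list \<Rightarrow> real" and e
      where "gk_model UNIV S e" and eval: "\<And>\<psi>. \<psi> \<in> F \<Longrightarrow> gk_eval UNIV S e [] \<psi> = 1 \<longleftrightarrow> \<psi> \<in> P"
      using countermodel[OF P(1)] by blast
    moreover have "\<forall>\<theta>\<in>T. gk_eval UNIV S e [] \<theta> = 1"
      using eval P(2) \<open>insert \<phi> T \<subseteq> F\<close> by blast
    ultimately have "gk_eval UNIV S e [] \<phi> = 1"
      using gk_entails_countable[OF entails assms(2)] by blast
    then show False using eval P(3) \<open>insert \<phi> T \<subseteq> F\<close> by blast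
  qed
qed (rule soundness)

end
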